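(* Let $f:\mathbb{R}^{n\times p}\to\mathbb{R}$ be locally Lipschitz continuous and suppose: (A1) $f$ is path differentiable; (A2) the set $\{f(X):X\in\mathcal{S}_{n,p},\ 0\in\partial_{\mathcal P}f(X)\}$ has empty interior in $\mathbb{R}$. Let $\mathcal{D}_f$ be a conservative field that admits $f$ as its potential function, let $\beta>0$, let $X_0\in\Omega_{1/6}$, and let $\{X_k\}_{k\ge0}$ be generated by $$X_{k+1}=X_k-\eta_k\left(D_k+\beta X_k(X_k^\top X_k-I_p)\right),\qquad k\ge0,$$ where $D_k\in\mathbb{R}^{n\times p}$ and $\eta_k\in\mathbb{R}$ satisfy: (C1) for every $k\ge0$, $D_k=G_k+E_k$, where $\lim_{N\to\infty}\sum_{k=0}^N\eta_kE_k$ exists, and for any subsequence $\{X_{k_j}\}$ converging to some $\tilde X$, $$\lim_{N\to\infty}\mathrm{dist}\Big(\frac1N\sum_{j=1}^NG_{k_j},\ \mathcal{J}_{\mathcal A}(\tilde X)[\mathcal{D}_f(\mathcal{A}(\tilde X))]\Big)=0;$$ (C2) there are constants $\tilde M,\hat M$ such that $\sup_{k\ge0}\|D_k\|_{\mathrm F}\le\tilde M$ and $\sup\{\|D\|_{\mathrm F}:X\in\Omega_{1/6},\ D\in\mathcal{D}_f(X)\}\le\hat M$, and $\beta\ge\max\{16M_1,60\tilde M,16\hat M\}$; (C3) $\eta_k>0$ for all $k$, $\sum_{k=0}^\infty\eta_k=\infty$, $\sum_{k=0}^\infty\eta_k^2<\infty$, and $\sup_{k\ge0}\eta_k\le\frac1{2\beta}$;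 (C4) the set $\{f(X):X\in\mathcal{S}_{n,p},\ 0\in\mathcal{J}_{\mathcal A}(X)[\mathcal{D}_f(X)]\}$ has empty interior in $\mathbb{R}$. Then $\{h(X_k)\}$ converges and every cluster point $X^*$ of $\{X_k\}$ lies in the set $\{X\in\mathcal{S}_{n,p}:0\in\mathcal{J}_{\mathcal A}(X)[\mathcal{D}_f(X)]\}$.
   Context: $\|\cdot\|_{\mathrm F}$ is the Frobenius norm, $\langle X,Y\rangle=\mathrm{tr}(X^\top Y)$, $\mathrm{dist}(Z,S)=\inf_{D\in S}\|Z-D\|_{\mathrm F}$, $\Phi(M)=\frac12(M+M^\top)$. $\partial$ is the Clarke subdifferential. $\mathcal{S}_{n,p}=\{X\in\mathbb{R}^{n\times p}:X^\top X=I_p\}$; $\Omega_r=\{X\in\mathbb{R}^{n\times p}:\|X^\top X-I_p\|_{\mathrm F}\le r\}$; for $X\in\mathcal{S}_{n,p}$, $\partial_{\mathcal P}f(X)=\{W-X\Phi(X^\top W):W\in\partial f(X)\}$. $M_1=\sup\{\|W\|_{\mathrm F}:X\in\Omega_1,\ W\in\partial f(X)\}$. $\mathcal{A}(X)=\frac18X\left(15I_p-10X^\top X+3(X^\top X)^2\right)$; $\mathcal{J}_{\mathcal A}(X)$ is the derivative of $\mathcal{A}$ at $X$ as a linear map on $\mathbb{R}^{n\times p}$, and $\mathcal{J}_{\mathcal A}(X)[\mathcal F]=\{\mathcal{J}_{\mathcal A}(X)[D]:D\in\mathcal F\}$ for a set $\mathcal F$. $h(X)=f(\mathcal{A}(X))+\frac\beta4\|X^\top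 X-I_p\|_{\mathrm F}^2$. $f$ is path differentiable means that $f$ admits a chain rule: for any absolutely continuous curve $\gamma:[0,\infty)\to\mathbb{R}^{n\times p}$, for almost every $t\ge0$, $(f\circ\gamma)'(t)=\langle V,\gamma'(t)\rangle$ for all $V\in\partial f(\gamma(t))$. Conservative field: a set-valued map $\mathcal{D}$ from $\mathbb{R}^{n\times p}$ to subsets of $\mathbb{R}^{n\times p}$ with closed graph and nonempty compact values such that for any absolutely continuous curve $\gamma:[0,1]\to\mathbb{R}^{n\times p}$ with $\gamma(0)=\gamma(1)$, $\int_0^1\max_{v\in\mathcal{D}(\gamma(t))}\langle\gamma'(t),v\rangle\,\mathrm{d}t=0$ (Lebesgue integral). $\mathcal{D}$ admits $f$ as its potential function if for all $X_0,X$ and every absolutely continuous $\gamma:[0,1]\to\mathbb{R}^{n\times p}$ with $\gamma(0)=X_0$, $\gamma(1)=X$, $f(X)=f(X_0)+\int_0^1\max_{v\in\mathcal{D}(\gamma(t))}\langle\gamma'(t),v\rangle\,\mathrm{d}t=f(X_0)+\int_0^1\min_{v\in\mathcal{D}(\gamma(t))}\langle\gamma'(t),v\rangle\,\mathrm{d}t$. *)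

theory Defs
  imports "HOL-Analysis.Analysis"
begin

definition locally_lipschitz :: "('a::metric_space \<Rightarrow> 'b::metric_space) \<Rightarrow> bool" where
  "locally_lipschitz f \<longleftrightarrow> (\<forall>x. \<exists>u>0. \<exists>L. L-lipschitz_on (cball x u) f)"

text \<open>The base point \<open>y\<close> ranges over full neighbourhoods of \<open>x\<close>, including \<open>y = x\<close>.
  Working in \<^typ>\<open>ereal\<close> makes the upper limit meaningful for every function.\<close>

definition clarke_dir_deriv :: "('a::real_inner \<Rightarrow> real) \<Rightarrow> 'a \<Rightarrow> 'a \<Rightarrow> ereal" where
  "clarke_dir_deriv f x d =
     Limsup (nhds x \<times>\<^sub>F at_right (0::real)) (\<lambda>(y, t). ereal ((f (y + t *\<^sub>R d) - f y) / t))"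

definition clarke_subdiff :: "('a::real_inner \<Rightarrow> real) \<Rightarrow> 'a \<Rightarrow> 'a set" where
  "clarke_subdiff f x = {w. \<forall>d. ereal (w \<bullet> d) \<le> clarke_dir_deriv f x d}"

text \<open>The epsilon-delta definition: \<open>d\<close> is a finite family of non-overlapping compact
  intervals contained in \<open>S\<close>, with end points \<open>Inf k\<close> and \<open>Sup k\<close> for \<open>k \<in> d\<close>.\<close>

definition abs_continuous_on :: "real set \<Rightarrow> (real \<Rightarrow> 'a::real_normed_vector) \<Rightarrow> bool" where
  "abs_continuous_on S \<gamma> \<longleftrightarrow>
     (\<forall>\<epsilon>>0. \<exists>\<delta>>0. \<forall>d T. d division_of T \<and> T \<subseteq> S \<and> (\<Sum>k\<in>d. Sup k - Inf k) < \<delta> \<longrightarrow>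
        (\<Sum>k\<in>d. norm (\<gamma> (Sup k) - \<gamma> (Inf k))) < \<epsilon>)"

definition path_differentiable :: "('a::euclidean_space \<Rightarrow> real) \<Rightarrow> bool" where
  "path_differentiable f \<longleftrightarrow>
     (\<forall>\<gamma>. abs_continuous_on {0..} \<gamma> \<longrightarrow>
       (AE t in lebesgue. 0 \<le> t \<longrightarrow>
         (\<exists>v. (\<gamma> has_vector_derivative v) (at t within {0..}) \<and>
              (\<forall>V\<in>clarke_subdiff f (\<gamma> t).
                 ((\<lambda>s. f (\<gamma> s)) has_real_derivative (V \<bullet> v)) (at t within {0..})))))"

text \<open>An absolutely continuous curve is differentiable almost everywhere, so the values of
  \<^const>\<open>vector_derivative\<close> at the remaining times do not influence the integrals below. For
  nonempty compact \<open>D x\<close> the supremum and infimum are a maximum and a minimum.\<close>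

definition max_speed :: "('a::euclidean_space \<Rightarrow> 'a set) \<Rightarrow> (real \<Rightarrow> 'a) \<Rightarrow> real \<Rightarrow> real" where
  "max_speed D \<gamma> t = (SUP v\<in>D (\<gamma> t). vector_derivative \<gamma> (at t within {0..1}) \<bullet> v)"

definition min_speed :: "('a::euclidean_space \<Rightarrow> 'a set) \<Rightarrow> (real \<Rightarrow> 'a) \<Rightarrow> real \<Rightarrow> real" where
  "min_speed D \<gamma> t = (INF v\<in>D (\<gamma> t). vector_derivative \<gamma> (at t within {0..1}) \<bullet> v)"

definition conservative_field :: "('a::euclidean_space \<Rightarrow> 'a set) \<Rightarrow> bool" where
  "conservative_field D \<longleftrightarrow>
     closed {(x, v). v \<in> D x} \<and>
     (\<forall>x. D x \<noteq> {} \<and> compact (D x)) \<and>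
     (\<forall>\<gamma>. abs_continuous_on {0..1} \<gamma> \<and> \<gamma> 0 = \<gamma> 1 \<longrightarrow>
        has_bochner_integral (lebesgue_on {0..1}) (max_speed D \<gamma>) 0)"

definition admits_potential :: "('a::euclidean_space \<Rightarrow> 'a set) \<Rightarrow> ('a \<Rightarrow> real) \<Rightarrow> bool" where
  "admits_potential D f \<longleftrightarrow>
     (\<forall>x\<^sub>0 x \<gamma>. abs_continuous_on {0..1} \<gamma> \<and> \<gamma> 0 = x\<^sub>0 \<and> \<gamma> 1 = x \<longrightarrow>
        integrable (lebesgue_on {0..1}) (max_speed D \<gamma>) \<and>
        integrable (lebesgue_on {0..1}) (min_speed D \<gamma>) \<and>
        f x = f x\<^sub>0 + (LINT t|lebesgue_on {0..1}. max_speed D \<gamma> t) \<and>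
        f x = f x\<^sub>0 + (LINT t|lebesgue_on {0..1}. min_speed D \<gamma> t))"

text \<open>An \<open>n \<times> p\<close> matrix is an element of \<^typ>\<open>real^'p^'n\<close>. The norm and inner product of this
  type are the Frobenius norm and \<open>trace (X\<^sup>T Y)\<close>:\<close>

lemma inner_matrix_eq_trace:
  fixes X Y :: "real^'p^'n"
  shows "X \<bullet> Y = trace (transpose X ** Y)"
  unfolding inner_vec_def trace_def matrix_matrix_mult_def transpose_def
  by (simp add: sum.swap[of _ "UNIV :: 'n set"])

lemma norm_matrix_eq_trace:
  fixes X :: "real^'p^'n"
  shows "norm X = sqrt (trace (transpose X ** X))"
  by (simp add: norm_eq_sqrt_inner inner_matrix_eq_trace)

definition stiefel :: "(real^'p^'n) set" where
  "stiefel = {X. transpose X ** X = mat 1}"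

definition \<Omega> :: "real \<Rightarrow> (real^'p^'n) set" where
  "\<Omega> r = {X. norm (transpose X ** X - mat 1) \<le> r}"

definition \<Phi> :: "real^'p^'p \<Rightarrow> real^'p^'p" where
  "\<Phi> M = (1/2) *\<^sub>R (M + transpose M)"

definition projected_subdiff :: "(real^'p^'n \<Rightarrow> real) \<Rightarrow> real^'p^'n \<Rightarrow> (real^'p^'n) set" where
  "projected_subdiff f X = {W - X ** \<Phi> (transpose X ** W) |W. W \<in> clarke_subdiff f X}"

definition M\<^sub>1 :: "(real^'p^'n \<Rightarrow> real) \<Rightarrow> real" where
  "M\<^sub>1 f = Sup {norm W |X W. X \<in> \<Omega> 1 \<and> W \<in> clarke_subdiff f X}"

definition \<A> :: "real^'p^'n \<Rightarrow> real^'p^'n" where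
  "\<A> X = (1/8) *\<^sub>R (X ** (15 *\<^sub>R mat 1 - 10 *\<^sub>R (transpose X ** X)
                         + 3 *\<^sub>R ((transpose X ** X) ** (transpose X ** X))))"

definition \<J>\<^sub>\<A> :: "real^'p^'n \<Rightarrow> real^'p^'n \<Rightarrow> real^'p^'n" where
  "\<J>\<^sub>\<A> X = frechet_derivative \<A> (at X)"

definition penalty :: "(real^'p^'n \<Rightarrow> real) \<Rightarrow> real \<Rightarrow> real^'p^'n \<Rightarrow> real" where
  "penalty f \<beta> X = f (\<A> X) + \<beta> / 4 * (norm (transpose X ** X - mat 1))\<^sup>2"

end

theory Submission
  imports Defs "HOL-Complex_Analysis.Great_Picard"
begin

text \<open>The limit curves of the iteration, obtained from the Arzela-Ascoli theorem, solve the differential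
  inclusion \<open>- x' \<in> \<J>\<^sub>\<A>(x)[D\<^sub>f(\<A>(x))] + \<beta> x (x\<^sup>T x - I)\<close>. Since \<open>\<A>\<close> is a gradient, \<open>\<J>\<^sub>\<A>(x)\<close> is
  symmetric, so the right-hand side is conservative with potential \<open>h\<close> and \<open>h\<close> decreases along a limit
  curve at rate \<open>\<parallel>x'\<parallel>\<^sup>2\<close>. A limit curve along which \<open>h\<close> does not decrease is therefore constant, and its
  value is stationary. If \<open>h(X\<^sub>k)\<close> oscillated, then upcrossings of a noncritical value would produce such a
  curve; if \<open>h(X\<^sub>k)\<close> converges, then every cluster point is the start of one. On \<open>\<Omega>(1/6)\<close>, which the
  iteration never leaves, stationary points are feasible because \<open>\<J>\<^sub>\<A>(x)\<close> maps the normal direction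
  \<open>x c\<close>, \<open>c = x\<^sup>T x - I\<close>, to \<open>(15/8) x c\<^sup>3\<close>, which is of third order in the infeasibility.\<close>

section \<open>Recursions driven by averaged directions\<close>

text \<open>The averaging hypothesis bounds no single \<open>G k\<close>, and the target set, a
  linear image of \<open>D\<^sub>f (\<A> x)\<close>, need not be convex, so the usual passage from
  averages to limits would give only its convex hull. The way out is that the hypothesis covers
  every subsequence, including those built adaptively: each index may be chosen once the sum of the
  earlier terms is known. Such choices give both the boundedness of \<open>G\<close> and membership
  in the set itself. The inclusion then supplies some element of the field at almost every time,
  with no control over which one. The potential repairs this: its maximum and minimum integrals
  agree, so almost everywhere every element yields the same rate of change. The constant 60 in the
  bound on \<open>\<beta>\<close> keeps a step inside \<open>\<Omega> (1/6)\<close>, and 16 lets the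
  penalty dominate in the normal direction. The third order there stems from \<open>\<A>\<close>
  being the second-order truncation of the polar projection.\<close>

lemma greedy_subsequence:
  fixes g :: "nat \<Rightarrow> 'a::comm_monoid_add"
  assumes "\<And>N n s. \<exists>k\<ge>N. Q n s k"
  obtains r :: "nat \<Rightarrow> nat" where "strict_mono r" "\<And>n. Q n (\<Sum>j<n. g (r j)) (r n)"
proof -
  \<comment> \<open>The state pairs the current index with the sum of \<open>g\<close> over all
    earlier indices, which makes that sum available to the next choice.\<close>
  have "\<exists>z. \<forall>n. (Q n (snd (z n)) (fst (z n)) \<and> (n = 0 \<longrightarrow> snd (z n) = 0)) \<and>
     (fst (z n) < fst (z (Suc n)) \<and> snd (z (Suc n)) = snd (z n) + g (fst (z n)))"
  proof (rule dependent_nat_choice)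
    obtain k where "Q 0 0 k" using assms[of 0 0 0] by blast
    then show "\<exists>x. Q 0 (snd x) (fst x) \<and> (0 = (0::nat) \<longrightarrow> snd x = 0)"
      by (intro exI[of _ "(k, 0)"]) auto
  next
    fix x :: "nat \<times> 'a" and n
    obtain k where "k \<ge> Suc (fst x)" "Q (Suc n) (snd x + g (fst x)) k"
      using assms by blast
    then show "\<exists>y. (Q (Suc n) (snd y) (fst y) \<and> (Suc n = 0 \<longrightarrow> snd y = 0)) \<and>
           fst x < fst y \<and> snd y = snd x + g (fst x)"
      by (intro exI[of _ "(k, snd x + g (fst x))"]) auto
  qed
  then obtain z where z: "\<And>n. Q n (snd (z n)) (fst (z n))" "snd (z 0) = 0"
    "\<And>n. fst (z n) < fst (z (Suc n))" "\<And>n. snd (z (Suc n)) = snd (z n) + g (fst (z n))"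
    by metis
  have "snd (z n) = (\<Sum>j<n. g (fst (z j)))" for n
    by (induction n) (auto simp: z)
  then show ?thesis
    using z by (intro that[of "\<lambda>n. fst (z n)"]) (auto simp: strict_mono_Suc_iff)
qed

lemma LIMSEQ_if_norm_less_inverse:
  fixes u :: "nat \<Rightarrow> 'a::real_normed_vector"
  assumes "\<And>n. norm (u n - x) < 1 / real (Suc n)"
  shows "u \<longlonglongrightarrow> x"
proof -
  have "(\<lambda>n. u n - x) \<longlonglongrightarrow> 0"
  proof (rule Lim_null_comparison[OF _ LIMSEQ_inverse_real_of_nat])
    show "\<forall>\<^sub>F n in sequentially. norm (u n - x) \<le> inverse (real (Suc n))"
      using assms by (simp add: divide_inverse less_imp_le)
  qed
  then show ?thesis by (rule LIM_zero_cancel)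
qed

text \<open>A cluster value \<open>L\<close> is approached infinitely often, and so is the region at
  distance at least \<open>e\<close> from it. Either the excursions above \<open>L + e\<close>
  recur, or they stop and those below \<open>L - e\<close> must recur.\<close>

lemma oscillates_if_not_convergent:
  fixes a :: "nat \<Rightarrow> real"
  assumes "bounded (range a)" "\<not> convergent a"
  obtains p q where "p < q" "\<And>N. \<exists>k\<ge>N. a k \<le> p" "\<And>N. \<exists>k\<ge>N. q \<le> a k"
proof -
  obtain L s where s: "strict_mono (s :: nat \<Rightarrow> nat)" "(a \<circ> s) \<longlonglongrightarrow> L"
    using bounded_imp_convergent_subsequence[OF assms(1)] by blast
  have "\<not> a \<longlonglongrightarrow> L" using assms(2) by (auto simp: convergent_def)
  then obtain e where e: "e > 0" "\<And>N. \<exists>k\<ge>N. e \<le> \<bar>a k - L\<bar>"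
    by (auto simp: LIMSEQ_def dist_real_def not_less)
  have near: "\<exists>k\<ge>N. \<bar>a k - L\<bar> < e / 2" for N
  proof -
    have "\<forall>\<^sub>F j in sequentially. \<bar>a (s j) - L\<bar> < e / 2"
      using tendstoD[OF s(2), of "e / 2"] e(1) by (simp add: dist_real_def)
    then obtain M where "\<And>j. j \<ge> M \<Longrightarrow> \<bar>a (s j) - L\<bar> < e / 2" by (auto simp: eventually_sequentially)
    then show ?thesis
      using seq_suble[OF s(1), of "max M N"] by (intro exI[of _ "s (max M N)"]) auto
  qed
  show ?thesis
  proof (cases "\<forall>N. \<exists>k\<ge>N. L + e \<le> a k")
    case True
    show ?thesis
    proof (rule that[of "L + e / 2" "L + e"])
      show "\<exists>k\<ge>N. a k \<le> L + e / 2" for N 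
      proof -
        obtain k where "k \<ge> N" "\<bar>a k - L\<bar> < e / 2" using near by blast
        then show ?thesis by (intro exI[of _ k] conjI) linarith+
      qed
    qed (use True e(1) in auto)
  next
    case False
    then obtain N0 where N0: "\<And>k. k \<ge> N0 \<Longrightarrow> a k < L + e" by (meson not_le)
    show ?thesis
    proof (rule that[of "L - e" "L - e / 2"])
      show "\<exists>k\<ge>N. a k \<le> L - e" for N
      proof -
        obtain k where "k \<ge> max N N0" "e \<le> \<bar>a k - L\<bar>" using e(2) by blast
        then show ?thesis using N0[of k] by (intro exI[of _ k]) auto
      qed
      show "\<exists>k\<ge>N. L - e / 2 \<le> a k" for N
      proof -
        obtain k where "k \<ge> N" "\<bar>a k - L\<bar> < e / 2" using near by blast
        then show ?thesis by (intro exI[of _ k] conjI) linarith+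
      qed
    qed (use e(1) in auto)
  qed
qed

text \<open>Two sequences separate the roles: directions are evaluated at \<open>X\<close>, while
  \<open>Y\<close> obeys the noise-free recursion exactly. Limits do not distinguish them, since
  their difference tends to zero.\<close>

locale averaged_recursion =
  fixes X Y G :: "nat \<Rightarrow> 'a::euclidean_space" and b :: "'a \<Rightarrow> 'a" and S :: "'a \<Rightarrow> 'a set"
    and \<eta> :: "nat \<Rightarrow> real" and K :: "'a set"
  assumes eta_pos: "\<eta> k > 0"
    and eta_lim: "\<eta> \<longlonglongrightarrow> 0"
    and eta_sum: "filterlim (\<lambda>n. \<Sum>k<n. \<eta> k) at_top sequentially"
    and compact_K: "compact K"
    and X_in_K: "X k \<in> K"
    and b_cont: "continuous_on UNIV b"
    and compact_S: "compact (S x)"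
    and S_nonempty: "S x \<noteq> {}"
    and averages: "strict_mono (r :: nat \<Rightarrow> nat) \<Longrightarrow> (\<lambda>j. X (r j)) \<longlonglongrightarrow> x \<Longrightarrow>
          (\<lambda>N. infdist ((1 / real N) *\<^sub>R (\<Sum>j<N. G (r j))) (S x)) \<longlonglongrightarrow> 0"
    and Y_diff_X: "(\<lambda>k. Y k - X k) \<longlonglongrightarrow> 0"
    and Y_Suc: "Y (Suc k) = Y k - \<eta> k *\<^sub>R (G k + b (X k))"
begin

text \<open>Along a subsequence on which \<open>G\<close> grows fast enough, even the averages of \<open>G\<close> blow up.\<close>

lemma bounded_G: "\<exists>R. \<forall>k. norm (G k) \<le> R"
proof (rule ccontr)
  assume "\<not> ?thesis"
  then have "\<forall>j::nat. \<exists>k. norm (G k) > real j" by (meson linorder_not_less)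
  then obtain k where k: "\<And>j::nat. norm (G (k j)) > real j" by metis
  obtain x l where l: "strict_mono l" and "((\<lambda>j. X (k j)) \<circ> l) \<longlonglongrightarrow> x"
    using seq_compactE[OF compact_imp_seq_compact[OF compact_K], of "\<lambda>j. X (k j)"] X_in_K by metis
  then have x: "(\<lambda>j. X (k (l j))) \<longlonglongrightarrow> x" by (simp add: o_def)
  have ex: "\<exists>i\<ge>N. norm (X i - x) < e \<and> norm (G i) \<ge> R" if "e > 0" for N e R
  proof -
    \<comment> \<open>\<open>B\<close> dominates the first terms, so a term of larger norm has an
      index beyond \<open>N\<close>.\<close>
    define B where "B = Max ((\<lambda>i. norm (G i)) ` {..N})"
    have B: "norm (G i) \<le> B" if "i \<le> N" for i
      unfolding B_def using that by (intro Max_ge) auto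
    have "eventually (\<lambda>j. norm (X (k (l j)) - x) < e) sequentially"
      using x that by (auto simp: tendsto_iff dist_norm)
    moreover have "eventually (\<lambda>j. real j \<ge> max R B) sequentially"
      using filterlim_real_sequentially unfolding filterlim_at_top by blast
    ultimately have "eventually (\<lambda>j. norm (X (k (l j)) - x) < e \<and> real j \<ge> max R B) sequentially"
      by eventually_elim auto
    then obtain j where j: "norm (X (k (l j)) - x) < e" "real j \<ge> max R B"
      by (auto dest: eventually_happens)
    have "real j \<le> real (l j)" using seq_suble[OF l] by simp
    then have "norm (G (k (l j))) > max R B" using k[of "l j"] j by linarith
    moreover from this have "k (l j) \<ge> N" using B[of "k (l j)"] by (cases "k (l j) \<le> N") auto
    ultimately show ?thesis using j by (intro exI[of _ "k (l j)"]) auto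
  qed
  \<comment> \<open>The term at position \<open>n\<close> outweighs all earlier ones by
    \<open>(n + 1)\<^sup>2\<close>, so the average of the first \<open>n + 1\<close> terms has norm
    at least \<open>n + 1\<close>.\<close>
  obtain r where r: "strict_mono r"
    "\<And>n. norm (X (r n) - x) < 1 / Suc n \<and> norm (G (r n)) \<ge> (Suc n)^2 + norm (\<Sum>j<n. G (r j))"
    by (rule greedy_subsequence[of "\<lambda>n s k. norm (X k - x) < 1 / Suc n \<and> norm (G k) \<ge> (Suc n)^2 + norm s" G])
       (use ex in \<open>auto\<close>)
  have Xr: "(\<lambda>n. X (r n)) \<longlonglongrightarrow> x" using r(2) by (intro LIMSEQ_if_norm_less_inverse) blast
  obtain C where C: "\<And>s. s \<in> S x \<Longrightarrow> norm s \<le> C"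
    using compact_imp_bounded[OF compact_S[of x]] by (auto simp: bounded_iff)
  have low: "real N \<le> infdist ((1 / real N) *\<^sub>R (\<Sum>j<N. G (r j))) (S x) + C" if N: "N > 0" for N
  proof -
    obtain n where n: "N = Suc n" using N gr0_implies_Suc by blast
    have "(real N)^2 \<le> norm (G (r n)) - norm (\<Sum>j<n. G (r j))" using r(2)[of n] n by simp
    also have "\<dots> \<le> norm (\<Sum>j<N. G (r j))"
      using norm_triangle_ineq2[of "G (r n)" "- (\<Sum>j<n. G (r j))"] by (simp add: n add.commute)
    finally have "real N \<le> norm ((1 / real N) *\<^sub>R (\<Sum>j<N. G (r j)))"
      using N by (simp add: field_simps power2_eq_square)
    moreover obtain s where "s \<in> S x" "infdist ((1 / real N) *\<^sub>R (\<Sum>j<N. G (r j))) (S x) = dist ((1 / real N) *\<^sub>R (\<Sum>j<N. G (r j))) s"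
      using infdist_attains_inf[OF compact_imp_closed[OF compact_S] S_nonempty] by metis
    ultimately show ?thesis
      using C[of s] norm_triangle_ineq2[of "(1 / real N) *\<^sub>R (\<Sum>j<N. G (r j))" s]
      by (simp add: dist_norm)
  qed
  have "eventually (\<lambda>N. infdist ((1 / real N) *\<^sub>R (\<Sum>j<N. G (r j))) (S x) < 1) sequentially"
    using order_tendstoD(2)[OF averages[OF r(1) Xr], of 1] by simp
  moreover have "eventually (\<lambda>N. real N \<ge> C + 1) sequentially"
    using filterlim_real_sequentially unfolding filterlim_at_top by blast
  ultimately have "eventually (\<lambda>N. False) sequentially"
    using eventually_gt_at_top[of 0]
  proof eventually_elim
    case (elim N)
    then show ?case using low[of N] by linarith
  qed
  then show False by simp
qed

text \<open>The set \<open>S x\<close> need not be convex. Choosing each new index so that its term makes an almost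
  obtuse angle with the current partial sum keeps the partial sums of size \<open>O(\<surd>N)\<close>, so \<open>g\<close>
  is a limit of averages.\<close>

lemma average_mem_S:
  assumes "\<And>w N e. e > 0 \<Longrightarrow> \<exists>k\<ge>N. norm (X k - x) < e \<and> (G k - g) \<bullet> w \<le> e"
  shows "g \<in> S x"
proof -
  obtain R where R: "\<And>k. norm (G k) \<le> R" using bounded_G by blast
  \<comment> \<open>One more term adds to the squared norm at most 2, twice the bound on the inner
    product, plus the squared norm of the term.\<close>
  define C where "C = 2 + (R + norm g)\<^sup>2"
  have ex: "\<exists>k\<ge>N. norm (X k - x) < 1 / Suc n \<and> (G k - g) \<bullet> s \<le> 1" for N n s
  proof -
    obtain k where "k \<ge> N" "norm (X k - x) < 1 / Suc n \<and> (G k - g) \<bullet> s \<le> 1 / Suc n"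
      using assms[of "1 / Suc n" N s] by auto
    moreover have "1 / real (Suc n) \<le> 1" by simp
    ultimately show ?thesis using order_trans by blast
  qed
  \<comment> \<open>The direction \<open>w\<close> of the hypothesis is taken to be the partial sum
    accumulated so far.\<close>
  obtain r where r: "strict_mono r"
    "\<And>n. norm (X (r n) - x) < 1 / Suc n \<and> (G (r n) - g) \<bullet> (\<Sum>j<n. G (r j) - g) \<le> 1"
    by (rule greedy_subsequence[of "\<lambda>n s k. norm (X k - x) < 1 / Suc n \<and> (G k - g) \<bullet> s \<le> 1" "\<lambda>k. G k - g"])
       (use ex in auto)
  have Xr: "(\<lambda>n. X (r n)) \<longlonglongrightarrow> x" using r(2) by (intro LIMSEQ_if_norm_less_inverse) blast
  have sq: "(norm (\<Sum>j<n. G (r j) - g))\<^sup>2 \<le> C * real n" for n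
  proof (induction n)
    case (Suc n)
    let ?s = "\<Sum>j<n. G (r j) - g" and ?d = "G (r n) - g"
    have "norm ?d \<le> R + norm g" using norm_triangle_ineq4[of "G (r n)" g] R[of "r n"] by linarith
    then have "(norm ?d)\<^sup>2 \<le> (R + norm g)\<^sup>2" by (simp add: power_mono)
    moreover have "(norm (?s + ?d))\<^sup>2 = (norm ?s)\<^sup>2 + 2 * (?d \<bullet> ?s) + (norm ?d)\<^sup>2"
      by (simp only: power2_norm_eq_inner inner_add_left inner_add_right inner_commute[of ?s ?d])
    ultimately show ?case using Suc r(2)[of n] by (simp add: C_def algebra_simps)
  qed simp
  have eq: "(1 / real N) *\<^sub>R (\<Sum>j<N. G (r j)) - g = (1 / real N) *\<^sub>R (\<Sum>j<N. G (r j) - g)" if "N > 0" for N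
    using that by (simp add: sum_subtractf scaleR_diff_right sum_constant_scaleR)
  have bd: "norm ((1 / real N) *\<^sub>R (\<Sum>j<N. G (r j)) - g) \<le> sqrt (C / real N)" if "N > 0" for N
  proof (rule real_le_rsqrt)
    have "(norm ((1 / real N) *\<^sub>R (\<Sum>j<N. G (r j)) - g))\<^sup>2 = (1/real N)\<^sup>2 * (norm (\<Sum>j<N. G (r j) - g))\<^sup>2"
      unfolding eq[OF that] norm_scaleR power_mult_distrib by simp
    also have "\<dots> \<le> (1/real N)\<^sup>2 * (C * real N)" by (intro mult_left_mono sq) auto
    also have "\<dots> = C / real N" using that by (simp add: power2_eq_square)
    finally show "(norm ((1 / real N) *\<^sub>R (\<Sum>j<N. G (r j)) - g))\<^sup>2 \<le> C / real N" .
  qed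
  have "\<forall>\<^sub>F N in sequentially. norm ((1 / real N) *\<^sub>R (\<Sum>j<N. G (r j)) - g) \<le> sqrt (C / real N)"
    using eventually_gt_at_top[of 0] by eventually_elim (rule bd)
  moreover have "(\<lambda>N. sqrt (C / real N)) \<longlonglongrightarrow> 0"
    using tendsto_real_sqrt[OF lim_const_over_n[of C]] by simp
  ultimately have "(\<lambda>N. (1 / real N) *\<^sub>R (\<Sum>j<N. G (r j)) - g) \<longlonglongrightarrow> 0"
    by (rule Lim_null_comparison)
  then have "(\<lambda>N. (1 / real N) *\<^sub>R (\<Sum>j<N. G (r j))) \<longlonglongrightarrow> g" by (rule LIM_zero_cancel)
  then have "(\<lambda>N. infdist ((1 / real N) *\<^sub>R (\<Sum>j<N. G (r j))) (S x)) \<longlonglongrightarrow> infdist g (S x)"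
    by (rule tendsto_infdist)
  then have "infdist g (S x) = 0" using averages[OF r(1) Xr] by (rule LIMSEQ_unique)
  then show ?thesis
    using in_closed_iff_infdist_zero[OF compact_imp_closed[OF compact_S] S_nonempty] by simp
qed

section \<open>Interpolation of the recursion in continuous time\<close>

definition tm :: "nat \<Rightarrow> real" where "tm n = (\<Sum>k<n. \<eta> k)"

definition U :: "nat \<Rightarrow> 'a" where "U k = G k + b (X k)"

lemma tm_0 [simp]: "tm 0 = 0" and tm_Suc: "tm (Suc n) = tm n + \<eta> n"
  by (auto simp: tm_def)

lemma strict_mono_tm: "strict_mono tm"
  unfolding strict_mono_Suc_iff using eta_pos by (simp add: tm_Suc)

lemma mono_tm: "m \<le> n \<Longrightarrow> tm m \<le> tm n"
  using strict_mono_tm by (simp add: strict_mono_less_eq)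

lemma tm_nonneg: "tm n \<ge> 0"
  using mono_tm[of 0 n] by simp

lemma tm_unbounded: "\<exists>n. t \<le> tm n"
  using filterlim_at_top[of tm sequentially] eta_sum
  by (auto simp: tm_def[abs_def] eventually_sequentially)

lemma tm_window:
  assumes "t \<ge> 0"
  obtains k where "tm k \<le> t" "t < tm (Suc k)"
proof -
  obtain n where n: "t + 1 \<le> tm n" using tm_unbounded by blast
  define m where "m = (LEAST n. t < tm n)"
  have m: "t < tm m" unfolding m_def by (rule LeastI[of _ n]) (use n in linarith)
  have "m \<noteq> 0" using m assms by (intro notI) simp
  then obtain k where k: "m = Suc k" using not0_implies_Suc by blast
  have "\<not> t < tm k" using not_less_Least[of k "\<lambda>n. t < tm n"] k by (simp add: m_def)
  then show ?thesis using that[of k] m k by simp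
qed

lemma bounded_U: "\<exists>R>0. \<forall>k. norm (U k) \<le> R"
proof -
  obtain R where R: "\<And>k. norm (G k) \<le> R" using bounded_G by blast
  have "compact (b ` K)"
    using compact_continuous_image[OF continuous_on_subset[OF b_cont] compact_K] by simp
  then obtain B where B: "\<And>x. x \<in> K \<Longrightarrow> norm (b x) \<le> B"
    using compact_imp_bounded[of "b ` K"] unfolding bounded_iff by blast
  have "norm (U k) \<le> max 1 (R + B)" for k
    using norm_triangle_ineq[of "G k" "b (X k)"] R[of k] B[OF X_in_K, of k] by (simp add: U_def)
  then show ?thesis by (intro exI[of _ "max 1 (R + B)"]) auto
qed

text \<open>The length of the part of \<open>[tm k, tm (Suc k)]\<close> lying before time
  \<open>t\<close>. It describes the interpolant as one sum, without cases on the piece that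
  contains \<open>t\<close>.\<close>

definition clk :: "nat \<Rightarrow> real \<Rightarrow> real" where "clk k t = max 0 (min (t - tm k) (\<eta> k))"

lemma clk_mono: "s \<le> t \<Longrightarrow> clk k s \<le> clk k t"
  by (auto simp: clk_def)

lemma sum_clk: "0 \<le> t \<Longrightarrow> t \<le> tm n \<Longrightarrow> (\<Sum>k<n. clk k t) = t"
proof -
  assume t: "0 \<le> t" "t \<le> tm n"
  have "(\<Sum>k<n. clk k t) = min t (tm n)"
  proof (induction n)
    case (Suc n)
    show ?case using Suc eta_pos[of n] by (auto simp: clk_def tm_Suc min_def max_def)
  qed (use t in simp)
  then show ?thesis using t by simp
qed

text \<open>The piecewise affine interpolation of \<open>Y\<close> satisfies the last condition because its increments
  are combinations of the vectors \<open>- U k\<close>, weighted with the times spent in the respective pieces.\<close>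

definition interpolant :: "real \<Rightarrow> (real \<Rightarrow> 'a) \<Rightarrow> bool" where
  "interpolant R y \<longleftrightarrow> R > 0 \<and> R-lipschitz_on {0..} y \<and> (\<forall>k. y (tm k) = Y k) \<and>
     (\<forall>s t w. 0 \<le> s \<and> s < t \<longrightarrow>
       (\<exists>k. tm k < t \<and> s < tm (Suc k) \<and> (t - s) * (U k \<bullet> w) \<le> (y s - y t) \<bullet> w))"

lemma interpolant_exists: "\<exists>R y. interpolant R y"
proof -
  obtain R where R: "R > 0" "\<And>k. norm (U k) \<le> R" using bounded_U by blast
  \<comment> \<open>\<open>N t\<close> only truncates the sum after the last piece begun by time
    \<open>t\<close>; any later truncation adds zero terms.\<close>
  define N where "N t = (LEAST n. t \<le> tm n)" for t
  define y where "y t = Y 0 - (\<Sum>k<N t. clk k t *\<^sub>R U k)" for t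
  have N: "t \<le> tm (N t)" for t unfolding N_def by (rule LeastI_ex[OF tm_unbounded])
  have y_eq: "y t = Y 0 - (\<Sum>k<n. clk k t *\<^sub>R U k)" if "t \<le> tm n" for t n
  proof -
    have "N t \<le> n" unfolding N_def using that by (rule Least_le)
    moreover have "clk k t = 0" if "N t \<le> k" for k
      using mono_tm[OF that] N[of t] by (simp add: clk_def)
    ultimately have "(\<Sum>k<N t. clk k t *\<^sub>R U k) = (\<Sum>k<n. clk k t *\<^sub>R U k)"
      by (intro sum.mono_neutral_left) auto
    then show ?thesis by (simp add: y_def)
  qed
  have y_tm: "y (tm k) = Y k" for k
  proof -
    have "clk i (tm k) = \<eta> i" if "i < k" for i
      using mono_tm[of "Suc i" k] that eta_pos[of i] by (simp add: clk_def tm_Suc)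
    then have "y (tm k) = Y 0 - (\<Sum>i<k. \<eta> i *\<^sub>R U i)" by (simp add: y_eq[of _ k])
    also have "\<dots> = Y k" by (induction k) (simp_all add: Y_Suc U_def algebra_simps)
    finally show ?thesis .
  qed
  have inc: "\<exists>n d. (\<forall>k. d k \<ge> 0 \<and> (d k > 0 \<longrightarrow> tm k < t \<and> s < tm (Suc k))) \<and>
      (\<Sum>k<n. d k) = t - s \<and> y s - y t = (\<Sum>k<n. d k *\<^sub>R U k)" if st: "0 \<le> s" "s \<le> t" for s t
  proof -
    obtain n where n: "t \<le> tm n" using tm_unbounded by blast
    let ?d = "\<lambda>k. clk k t - clk k s"
    have "tm k < t \<and> s < tm (Suc k)" if "?d k > 0" for k
      using that eta_pos[of k] by (auto simp: clk_def tm_Suc max_def min_def split: if_splits)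
    moreover have "(\<Sum>k<n. ?d k) = t - s" using n st by (simp add: sum_subtractf sum_clk)
    moreover have "y s - y t = (\<Sum>k<n. ?d k *\<^sub>R U k)"
      using n st by (simp add: y_eq[of _ n] sum_subtractf scaleR_diff_left)
    ultimately show ?thesis using clk_mono[OF st(2)] by (intro exI[of _ n] exI[of _ ?d]) auto
  qed
  have lip: "norm (y s - y t) \<le> R * (t - s)" if st: "0 \<le> s" "s \<le> t" for s t
  proof -
    obtain n d where d: "\<And>k. d k \<ge> 0" "(\<Sum>k<n. d k) = t - s" "y s - y t = (\<Sum>k<n. d k *\<^sub>R U k)"
      using inc[OF st] by blast
    have "norm (y s - y t) \<le> (\<Sum>k<n. norm (d k *\<^sub>R U k))" unfolding d by (rule norm_sum)
    also have "\<dots> \<le> (\<Sum>k<n. d k * R)" using d(1) R by (intro sum_mono) (simp add: mult_left_mono)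
    also have "\<dots> = R * (t - s)" by (simp add: d(2)[symmetric] sum_distrib_left mult.commute)
    finally show ?thesis .
  qed
  have "interpolant R y"
    unfolding interpolant_def
  proof (intro conjI allI impI R(1) y_tm)
    show "R-lipschitz_on {0..} y"
      by (rule lipschitz_on_leI) (use lip R(1) in \<open>auto simp: dist_norm\<close>)
  next
    fix s t :: real and w :: 'a
    assume st: "0 \<le> s \<and> s < t"
    obtain n d where d: "\<And>k. d k \<ge> 0" "\<And>k. d k > 0 \<Longrightarrow> tm k < t \<and> s < tm (Suc k)"
      "(\<Sum>k<n. d k) = t - s" "y s - y t = (\<Sum>k<n. d k *\<^sub>R U k)"
      using inc[of s t] st by auto
    \<comment> \<open>The mean velocity is an average of the vectors \<open>U k\<close> with weights
      \<open>d k / (t - s)\<close>. If every active piece exceeded it in direction \<open>w\<close>,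
      the average would exceed itself.\<close>
    show "\<exists>k. tm k < t \<and> s < tm (Suc k) \<and> (t - s) * (U k \<bullet> w) \<le> (y s - y t) \<bullet> w"
    proof (rule ccontr)
      assume "\<not> ?thesis"
      then have gt: "(y s - y t) \<bullet> w < (t - s) * (U k \<bullet> w)" if "d k > 0" for k
        using d(2)[OF that] by force
      have ge: "d k * ((y s - y t) \<bullet> w) \<le> d k * ((t - s) * (U k \<bullet> w))" for k
        using gt[of k] d(1)[of k] by (cases "d k = 0") (auto simp: mult_left_mono)
      have "\<exists>k<n. d k > 0"
      proof (rule ccontr)
        assume "\<not> ?thesis"
        then have "(\<Sum>k<n. d k) = 0" using d(1) by (intro sum.neutral ballI) (metis lessThan_iff order_le_less)
        then show False using d(3) st by simp
      qed
      then obtain i where i: "i < n" "d i > 0" by blast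
      have "(\<Sum>k<n. d k * ((y s - y t) \<bullet> w)) < (\<Sum>k<n. d k * ((t - s) * (U k \<bullet> w)))"
      proof (rule sum_strict_mono_ex1)
        show "\<exists>a\<in>{..<n}. d a * ((y s - y t) \<bullet> w) < d a * ((t - s) * (U a \<bullet> w))"
          using gt[OF i(2)] i by (intro bexI[of _ i]) auto
      qed (use ge in auto)
      moreover have "(\<Sum>k<n. d k * ((y s - y t) \<bullet> w)) = (t - s) * ((y s - y t) \<bullet> w)"
        by (simp add: d(3)[symmetric] sum_distrib_right)
      moreover have "(\<Sum>k<n. d k * ((t - s) * (U k \<bullet> w))) = (t - s) * ((y s - y t) \<bullet> w)"
        unfolding d(4) inner_sum_left sum_distrib_left by (intro sum.cong) auto
      ultimately show False by simp
    qed
  qed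
  then show ?thesis by blast
qed

text \<open>On a short window after \<open>t\<close>, the mean slope of the shifted interpolant is
  close to \<open>v\<close>, and for each \<open>w\<close> some piece meeting the window satisfies
  \<open>U k \<bullet> w \<le> - v \<bullet> w\<close> up to a small error. This index depends on
  \<open>w\<close>, which is the order of quantifiers that \<open>average_mem_S\<close>
  allows.\<close>

lemma limit_curve_inclusion:
  assumes interp: "interpolant R y"
    and m: "filterlim m at_top sequentially"
    and unif: "\<And>e. e > 0 \<Longrightarrow> \<exists>N. \<forall>j\<ge>N. \<forall>s\<in>{0..T}. norm (y (tm (m j) + s) - x s) < e"
    and t: "0 < t" "t < T"
    and deriv: "(x has_vector_derivative v) (at t)"
  shows "- v - b (x t) \<in> S (x t)"
proof (rule average_mem_S)
  have y: "R > 0" "R-lipschitz_on {0..} y" "\<And>k. y (tm k) = Y k"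
    "\<And>s t w. 0 \<le> s \<Longrightarrow> s < t \<Longrightarrow>
       \<exists>k. tm k < t \<and> s < tm (Suc k) \<and> (t - s) * (U k \<bullet> w) \<le> (y s - y t) \<bullet> w"
    using interp unfolding interpolant_def by blast+
  fix w :: 'a and N :: nat and e :: real
  assume e: "e > 0"
  \<comment> \<open>Four errors of size \<open>\<kappa> * norm w\<close> arise: three in the
    increment of the interpolant and one in \<open>b\<close>. Together they stay below
    \<open>e / 2\<close>.\<close>
  define \<kappa> where "\<kappa> = e / (8 * (norm w + 1))"
  have w1: "norm w + 1 > 0" using norm_ge_zero[of w] by linarith
  have \<kappa>: "\<kappa> > 0" "\<kappa> * norm w \<le> e / 8"
    using e w1 by (auto simp: \<kappa>_def field_simps)
  obtain \<delta> where \<delta>: "\<delta> > 0" "\<And>u. norm (u - x t) < \<delta> \<Longrightarrow> norm (b u - b (x t)) < \<kappa>"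
    using b_cont \<kappa>(1) unfolding continuous_on_iff by (metis UNIV_I dist_norm)
  define \<epsilon> where "\<epsilon> = min e \<delta>"
  have \<epsilon>: "\<epsilon> > 0" "\<epsilon> \<le> e" "\<epsilon> \<le> \<delta>" using e \<delta> by (auto simp: \<epsilon>_def)
  obtain d where d: "d > 0" "\<And>s. \<bar>s\<bar> < d \<Longrightarrow> norm (x (t + s) - x t - s *\<^sub>R v) \<le> \<kappa> * \<bar>s\<bar>"
  proof -
    obtain d where d: "d > 0" "\<And>u. norm (u - t) < d \<Longrightarrow> norm (x u - x t - (u - t) *\<^sub>R v) \<le> \<kappa> * norm (u - t)"
      using deriv \<kappa>(1) unfolding has_vector_derivative_def has_derivative_at_alt by blast
    have "norm (x (t + s) - x t - s *\<^sub>R v) \<le> \<kappa> * \<bar>s\<bar>" if "\<bar>s\<bar> < d" for s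
      using d(2)[of "t + s"] that by simp
    with d(1) show ?thesis using that by blast
  qed
  \<comment> \<open>The three bounds serve the derivative estimate, the end point \<open>T\<close>,
    and the distance travelled by \<open>y\<close> within the window.\<close>
  define s where "s = min (d / 2) (min ((T - t) / 2) (\<epsilon> / (8 * R)))"
  have s: "s > 0" "s < d" "t + s < T" "R * s < \<epsilon> / 4"
  proof -
    show "s > 0" using d t \<epsilon> y(1) by (simp add: s_def)
    have "s \<le> d / 2" "s \<le> (T - t) / 2" and s3: "s \<le> \<epsilon> / (8 * R)"
      unfolding s_def by linarith+
    then show "s < d" "t + s < T" using d t by auto
    have "R * s \<le> R * (\<epsilon> / (8 * R))" using s3 y(1) by (intro mult_left_mono) auto
    also have "\<dots> < \<epsilon> / 4" using y(1) \<epsilon> by simp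
    finally show "R * s < \<epsilon> / 4" .
  qed
  have "eventually (\<lambda>k. R * \<eta> k < \<epsilon> / 4) sequentially"
    using order_tendstoD(2)[OF tendsto_mult_right_zero[OF eta_lim, of R], of "\<epsilon> / 4"] \<epsilon> by simp
  moreover have "eventually (\<lambda>k. norm (Y k - X k) < \<epsilon> / 4) sequentially"
    using order_tendstoD(2)[OF tendsto_norm_zero[OF Y_diff_X], of "\<epsilon> / 4"] \<epsilon> by simp
  ultimately have "eventually (\<lambda>k. R * \<eta> k < \<epsilon> / 4 \<and> norm (Y k - X k) < \<epsilon> / 4) sequentially"
    by eventually_elim simp
  then obtain M where M: "\<And>k. k \<ge> M \<Longrightarrow> R * \<eta> k < \<epsilon> / 4 \<and> norm (Y k - X k) < \<epsilon> / 4"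
    by (auto simp: eventually_sequentially)
  \<comment> \<open>Closeness is required relative to \<open>s\<close>, because these errors are
    later divided by the length of the window.\<close>
  obtain J where J: "\<And>j s'. j \<ge> J \<Longrightarrow> s' \<in> {0..T} \<Longrightarrow>
      norm (y (tm (m j) + s') - x s') < min (\<kappa> * s) (\<epsilon> / 4)"
  proof -
    have "min (\<kappa> * s) (\<epsilon> / 4) > 0" using \<kappa> s \<epsilon> by simp
    from unif[OF this] show ?thesis using that by blast
  qed
  obtain J' where J': "\<And>j. j \<ge> J' \<Longrightarrow> m j \<ge> max M N"
    using m unfolding filterlim_at_top eventually_sequentially by meson
  define j where "j = max J J'"
  define a where "a = tm (m j) + t"
  have a0: "a \<ge> 0" using tm_nonneg[of "m j"] t by (simp add: a_def)
  have mj: "m j \<ge> M" "m j \<ge> N" using J'[of j] by (auto simp: j_def)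
  have ya: "norm (y a - x t) < min (\<kappa> * s) (\<epsilon> / 4)"
    using J[of j t] t by (auto simp: j_def a_def)
  have yas: "norm (y (a + s) - x (t + s)) < min (\<kappa> * s) (\<epsilon> / 4)"
    using J[of j "t + s"] t s by (auto simp: j_def a_def add.assoc)
  obtain k where k: "tm k < a + s" "a < tm (Suc k)" "s * (U k \<bullet> w) \<le> (y a - y (a + s)) \<bullet> w"
    using y(4)[of a "a + s" w] a0 s by auto
  have "tm (m j) < tm (Suc k)" using k(2) t by (simp add: a_def)
  then have km: "k \<ge> m j" using mono_tm[of "Suc k" "m j"] by (meson not_less not_less_eq_eq)
  \<comment> \<open>The piece may begin before the window, but by at most its own length
    \<open>\<eta> k\<close>.\<close>
  have "\<bar>tm k - a\<bar> \<le> max s (\<eta> k)" using k by (auto simp: tm_Suc)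
  then have "R * \<bar>tm k - a\<bar> \<le> R * max s (\<eta> k)" using y(1) by (intro mult_left_mono) auto
  also have "\<dots> < \<epsilon> / 4" using s(4) M[of k] km mj by (auto simp: max_def)
  finally have "norm (Y k - y a) < \<epsilon> / 4"
    using lipschitz_onD[OF y(2), of "tm k" a] tm_nonneg[of k] a0
    by (simp add: y(3) dist_norm)
  moreover have "norm (Y k - X k) < \<epsilon> / 4" using M[of k] km mj by simp
  moreover have "norm (X k - x t) \<le> norm (Y k - X k) + norm (Y k - y a) + norm (y a - x t)"
    using norm_triangle_ineq[of "X k - Y k" "(Y k - y a) + (y a - x t)"]
      norm_triangle_ineq[of "Y k - y a" "y a - x t"] by (simp add: norm_minus_commute)
  ultimately have Xk: "norm (X k - x t) < \<epsilon>" using ya \<epsilon> by auto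
  have "norm (y a - y (a + s) + s *\<^sub>R v) \<le> 3 * \<kappa> * s"
  proof -
    have "y a - y (a + s) + s *\<^sub>R v = (y a - x t) - (y (a + s) - x (t + s)) - (x (t + s) - x t - s *\<^sub>R v)"
      by simp
    then have "norm (y a - y (a + s) + s *\<^sub>R v) \<le> norm (y a - x t) + norm (y (a + s) - x (t + s)) + norm (x (t + s) - x t - s *\<^sub>R v)"
      by (metis (no_types, lifting) add_mono_thms_linordered_semiring(3) norm_triangle_ineq4 order_trans)
    then show ?thesis using ya yas d(2)[of s] s by auto
  qed
  then have "(y a - y (a + s) + s *\<^sub>R v) \<bullet> w \<le> 3 * \<kappa> * s * norm w"
    by (meson norm_cauchy_schwarz mult_right_mono norm_ge_zero order_trans)
  then have "s * (U k \<bullet> w + v \<bullet> w) \<le> s * (3 * \<kappa> * norm w)"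
    using k(3) by (simp add: inner_add_left inner_diff_left algebra_simps)
  then have 1: "U k \<bullet> w + v \<bullet> w \<le> 3 * (\<kappa> * norm w)" using s(1) by simp
  have "norm (b (X k) - b (x t)) * norm w \<le> \<kappa> * norm w"
    using \<delta>(2)[of "X k"] Xk \<epsilon> by (intro mult_right_mono) auto
  moreover have "- ((b (X k) - b (x t)) \<bullet> w) \<le> norm (b (X k) - b (x t)) * norm w"
    using norm_cauchy_schwarz[of "- (b (X k) - b (x t))" w]
    unfolding inner_minus_left norm_minus_cancel .
  ultimately have "- ((b (X k) - b (x t)) \<bullet> w) \<le> \<kappa> * norm w" by linarith
  moreover have "(G k - (- v - b (x t))) \<bullet> w = U k \<bullet> w + v \<bullet> w - (b (X k) - b (x t)) \<bullet> w"
    by (simp add: U_def inner_add_left inner_diff_left)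
  ultimately have "(G k - (- v - b (x t))) \<bullet> w \<le> e" using 1 \<kappa>(2) e by linarith
  moreover have "k \<ge> N" using km mj by simp
  ultimately show "\<exists>k\<ge>N. norm (X k - x t) < e \<and> (G k - (- v - b (x t))) \<bullet> w \<le> e"
    using Xk \<epsilon> by (intro exI[of _ k]) auto
qed

section \<open>Limit curves and Lyapunov functions\<close>

lemma bounded_Y: "\<exists>C. \<forall>k. norm (Y k) \<le> C"
proof -
  have "bounded (range (\<lambda>k. Y k - X k))"
    by (rule convergent_imp_bounded[OF Y_diff_X])
  then obtain C1 where C1: "\<And>k. norm (Y k - X k) \<le> C1" unfolding bounded_iff by blast
  obtain C2 where C2: "\<And>x. x \<in> K \<Longrightarrow> norm x \<le> C2"
    using compact_imp_bounded[OF compact_K] unfolding bounded_iff by blast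
  have "norm (Y k) \<le> C1 + C2" for k
    using C1[of k] C2[OF X_in_K, of k] norm_triangle_ineq[of "Y k - X k" "X k"] by simp
  then show ?thesis by blast
qed

text \<open>The interpolants started at the times \<open>tm (m j)\<close> have a limit curve from
  \<open>x\<^sub>0\<close>. The bound \<open>low\<close> keeps \<open>h\<close> from falling along
  it, and \<open>lyap\<close> then leaves no room to move. Only a window of fixed length
  \<open>T\<close> matters, so this serves both a convergent \<open>h (Y k)\<close> and one
  upcrossing at a time.\<close>

lemma stationary_if_no_descent:
  fixes h :: "'a \<Rightarrow> real"
  assumes h_cont: "continuous_on UNIV h"
    and lyap: "\<And>\<gamma> T L. T > 0 \<Longrightarrow> L-lipschitz_on {0..T} \<gamma> \<Longrightarrow>
       (\<And>t v. 0 < t \<Longrightarrow> t < T \<Longrightarrow> (\<gamma> has_vector_derivative v) (at t) \<Longrightarrow> - v - b (\<gamma> t) \<in> S (\<gamma> t)) \<Longrightarrow>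
       h (\<gamma> T) \<le> h (\<gamma> 0) - (norm (\<gamma> T - \<gamma> 0))\<^sup>2 / T"
    and m: "filterlim m at_top sequentially"
    and Ym: "(\<lambda>j. Y (m j)) \<longlonglongrightarrow> x\<^sub>0"
    and T: "T > 0"
    and low: "\<And>e. e > 0 \<Longrightarrow>
      \<forall>\<^sub>F j in sequentially. \<forall>k\<ge>m j. tm k \<le> tm (m j) + T \<longrightarrow> h x\<^sub>0 - e \<le> h (Y k)"
  shows "- b x\<^sub>0 \<in> S x\<^sub>0"
proof -
  obtain R y where interp: "interpolant R y" using interpolant_exists by blast
  then have y: "R > 0" "R-lipschitz_on {0..} y" "\<And>k. y (tm k) = Y k"
    unfolding interpolant_def by blast+
  have ylip: "norm (y s - y t) \<le> R * \<bar>s - t\<bar>" if "s \<ge> 0" "t \<ge> 0" for s t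
    using lipschitz_onD[OF y(2), of s t] that by (simp add: dist_norm)
  obtain C where C: "\<And>k. norm (Y k) \<le> C" using bounded_Y by blast
  have bdF: "norm (y (tm (m j) + s)) \<le> C + R * T" if "s \<in> {0..T}" for j s
  proof -
    have "norm (y (tm (m j) + s) - Y (m j)) \<le> R * s"
      using ylip[of "tm (m j) + s" "tm (m j)"] tm_nonneg[of "m j"] that by (simp add: y(3))
    also have "\<dots> \<le> R * T" using y(1) that by (intro mult_left_mono) auto
    finally show ?thesis
      using C[of "m j"] norm_triangle_ineq2[of "y (tm (m j) + s)" "Y (m j)"] by linarith
  qed
  have equi: "\<exists>d>0. \<forall>j u. u \<in> {0..T} \<and> norm (s - u) < d \<longrightarrow>
      norm (y (tm (m j) + s) - y (tm (m j) + u)) < e" if "s \<in> {0..T}" "e > 0" for s e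
  proof (intro exI[of _ "e / R"] conjI allI impI)
    show "e / R > 0" using that y(1) by simp
    fix j u assume u: "u \<in> {0..T} \<and> norm (s - u) < e / R"
    have "norm (y (tm (m j) + s) - y (tm (m j) + u)) \<le> R * \<bar>s - u\<bar>"
      using ylip[of "tm (m j) + s" "tm (m j) + u"] tm_nonneg[of "m j"] that u by simp
    also have "\<dots> < e" using u y(1) by (simp add: field_simps)
    finally show "norm (y (tm (m j) + s) - y (tm (m j) + u)) < e" .
  qed
  obtain x l where xl: "strict_mono (l :: nat \<Rightarrow> nat)"
    "\<And>e. 0 < e \<Longrightarrow> \<exists>N. \<forall>n s. n \<ge> N \<and> s \<in> {0..T} \<longrightarrow> norm (y (tm (m (l n)) + s) - x s) < e"
    by (rule Arzela_Ascoli[of "{0..T}" "\<lambda>j s. y (tm (m j) + s)" "C + R * T"])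
       (use bdF equi in auto)
  define p where "p = m \<circ> l"
  have p: "filterlim p at_top sequentially"
    unfolding p_def comp_def by (rule filterlim_compose[OF m filterlim_subseq[OF xl(1)]])
  have unif: "\<exists>N. \<forall>j\<ge>N. \<forall>s\<in>{0..T}. norm (y (tm (p j) + s) - x s) < e" if "e > 0" for e
    using xl(2)[OF that] unfolding p_def comp_apply by blast
  have xlim: "(\<lambda>j. y (tm (p j) + s)) \<longlonglongrightarrow> x s" if "s \<in> {0..T}" for s
    unfolding LIMSEQ_def dist_norm using unif that by blast
  have "(\<lambda>j. y (tm (p j) + 0)) \<longlonglongrightarrow> x\<^sub>0"
    using LIMSEQ_subseq_LIMSEQ[OF Ym xl(1)] by (simp add: y(3) p_def o_def)
  then have x0: "x 0 = x\<^sub>0" using xlim[of 0] T LIMSEQ_unique by force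
  have xlip: "R-lipschitz_on {0..T} x"
  proof (rule lipschitz_onI)
    fix s u assume su: "s \<in> {0..T}" "u \<in> {0..T}"
    have "(\<lambda>j. norm (y (tm (p j) + s) - y (tm (p j) + u))) \<longlonglongrightarrow> norm (x s - x u)"
      by (intro tendsto_intros xlim su)
    then have "norm (x s - x u) \<le> R * \<bar>s - u\<bar>"
    proof (rule LIMSEQ_le_const2)
      show "\<exists>N. \<forall>n\<ge>N. norm (y (tm (p n) + s) - y (tm (p n) + u)) \<le> R * \<bar>s - u\<bar>"
        using ylip[of "tm (p n) + s" "tm (p n) + u" for n] tm_nonneg su by simp
    qed
    then show "dist (x s) (x u) \<le> R * dist s u" by (simp add: dist_norm)
  qed (use y in simp)
  have incl: "- v - b (x t) \<in> S (x t)" if "0 < t" "t < T" "(x has_vector_derivative v) (at t)" for t v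
    using limit_curve_inclusion[OF interp p unif that] .
  have h_lim: "(\<lambda>j. h (u j)) \<longlonglongrightarrow> h z" if "u \<longlonglongrightarrow> z" for u :: "nat \<Rightarrow> 'a" and z
    using continuous_on_tendsto_compose[OF h_cont that] by simp
  have above: "h x\<^sub>0 \<le> h (x s)" if s: "s \<in> {0..T}" for s
  proof -
    \<comment> \<open>The bound \<open>low\<close> speaks of the iterates only. The last iterate
      before time \<open>tm (p j) + s\<close> is within \<open>R * \<eta> (k j)\<close> of the
      interpolant there, so its limit is \<open>x s\<close>.\<close>
    have "\<exists>k. tm k \<le> tm (p j) + s \<and> tm (p j) + s < tm (Suc k)" for j
      using tm_window[of "tm (p j) + s"] tm_nonneg[of "p j"] s by auto
    then obtain k where k: "\<And>j. tm (k j) \<le> tm (p j) + s" "\<And>j. tm (p j) + s < tm (Suc (k j))"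
      by metis
    have kp: "k j \<ge> p j" for j
    proof -
      have "tm (p j) < tm (Suc (k j))" using k(2)[of j] s by simp
      then show ?thesis using mono_tm[of "Suc (k j)" "p j"] by (meson not_less not_less_eq_eq)
    qed
    then have k_lim: "filterlim k at_top sequentially"
      by (intro filterlim_at_top_mono[OF p]) simp
    have near: "norm (Y (k j) - y (tm (p j) + s)) \<le> R * \<eta> (k j)" for j
    proof -
      have "norm (Y (k j) - y (tm (p j) + s)) \<le> R * \<bar>tm (k j) - (tm (p j) + s)\<bar>"
        using ylip[of "tm (k j)" "tm (p j) + s"] tm_nonneg s by (simp add: y(3))
      also have "\<dots> \<le> R * \<eta> (k j)" using k[of j] y(1) by (intro mult_left_mono) (auto simp: tm_Suc)
      finally show ?thesis .
    qed
    have "(\<lambda>j. R * \<eta> (k j)) \<longlonglongrightarrow> 0"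
      by (intro tendsto_mult_right_zero filterlim_compose[OF eta_lim k_lim])
    then have "(\<lambda>j. Y (k j) - y (tm (p j) + s)) \<longlonglongrightarrow> 0"
      by (rule Lim_null_comparison[OF always_eventually[OF allI[OF near]]])
    from tendsto_add[OF this xlim[OF s]] have "(\<lambda>j. Y (k j)) \<longlonglongrightarrow> x s" by simp
    then have hY: "(\<lambda>j. h (Y (k j))) \<longlonglongrightarrow> h (x s)" by (rule h_lim)
    show ?thesis
    proof (rule field_le_epsilon)
      fix e :: real assume "e > 0"
      have "\<forall>\<^sub>F j in sequentially. \<forall>k\<ge>p j. tm k \<le> tm (p j) + T \<longrightarrow> h x\<^sub>0 - e \<le> h (Y k)"
        unfolding p_def comp_def
        by (rule eventually_compose_filterlim[OF low[OF \<open>e > 0\<close>] filterlim_subseq[OF xl(1)]])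
      then have "\<forall>\<^sub>F j in sequentially. h x\<^sub>0 - e \<le> h (Y (k j))"
      proof eventually_elim
        case (elim j)
        then show ?case using kp[of j] k(1)[of j] s by simp
      qed
      then have "h x\<^sub>0 - e \<le> h (x s)" 
        by (rule tendsto_lowerbound[OF hY]) simp
      then show "h x\<^sub>0 \<le> h (x s) + e" by simp
    qed
  qed
  have const: "x s = x\<^sub>0" if s: "0 < s" "s < T" for s
  proof -
    have "h (x s) \<le> h (x 0) - (norm (x s - x 0))\<^sup>2 / s"
    proof (rule lyap[OF s(1)])
      show "R-lipschitz_on {0..s} x" by (rule lipschitz_on_subset[OF xlip]) (use s in auto)
    qed (use incl s in auto)
    then have "(norm (x s - x 0))\<^sup>2 / s \<le> 0" using above[of s] s x0 by simp
    then have "(norm (x s - x 0))\<^sup>2 \<le> 0" using s by (simp add: field_simps)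
    then show ?thesis using x0 by simp
  qed
  \<comment> \<open>The curve is constant near an interior time, so the inclusion there holds with
    zero velocity.\<close>
  have "(x has_vector_derivative 0) (at (T / 2))"
    by (rule has_vector_derivative_transform_within_open[where S = "{0<..<T}" and f = "\<lambda>_. x\<^sub>0"])
       (use T const in auto)
  from incl[OF _ _ this] show ?thesis using T const[of "T / 2"] by simp
qed

text \<open>If \<open>h (Y k)\<close> oscillated, it would cross a noncritical value \<open>r\<close> upwards infinitely often. Each
  crossing takes at least a fixed time, so a limit curve starts at level \<open>r\<close> and does not descend.\<close>

theorem lyapunov_convergence:
  fixes h :: "'a \<Rightarrow> real"
  assumes h_cont: "continuous_on UNIV h"
    and lyap: "\<And>\<gamma> T L. T > 0 \<Longrightarrow> L-lipschitz_on {0..T} \<gamma> \<Longrightarrow>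
       (\<And>t v. 0 < t \<Longrightarrow> t < T \<Longrightarrow> (\<gamma> has_vector_derivative v) (at t) \<Longrightarrow> - v - b (\<gamma> t) \<in> S (\<gamma> t)) \<Longrightarrow>
       h (\<gamma> T) \<le> h (\<gamma> 0) - (norm (\<gamma> T - \<gamma> 0))\<^sup>2 / T"
    and sard: "interior (h ` {x \<in> K. - b x \<in> S x}) = {}"
  shows "convergent (\<lambda>k. h (X k))"
    and "strict_mono (r :: nat \<Rightarrow> nat) \<Longrightarrow> (\<lambda>j. X (r j)) \<longlonglongrightarrow> x \<Longrightarrow> - b x \<in> S x"
proof -
  obtain C where C: "\<And>k. norm (Y k) \<le> C" using bounded_Y by blast
  obtain C2 where C2: "\<And>x. x \<in> K \<Longrightarrow> norm x \<le> C2"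
    using compact_imp_bounded[OF compact_K] unfolding bounded_iff by blast
  \<comment> \<open>A compact ball containing both sequences makes \<open>h\<close> uniformly
    continuous along them.\<close>
  define B where "B = cball (0::'a) (max C C2)"
  have YB: "Y k \<in> B" and XB: "X k \<in> B" for k
    using C[of k] C2[OF X_in_K, of k] by (auto simp: B_def)
  have uc: "uniformly_continuous_on B h"
    unfolding B_def by (intro compact_uniformly_continuous continuous_on_subset[OF h_cont]) auto
  have h_close: "(\<lambda>k. h (u k) - h (v k)) \<longlonglongrightarrow> 0"
    if "\<And>k. u k \<in> B" "\<And>k. v k \<in> B" "(\<lambda>k. u k - v k) \<longlonglongrightarrow> 0" for u v :: "nat \<Rightarrow> 'a"
    using uc[unfolded uniformly_continuous_on_sequentially, rule_format, of u v] that
    by (simp add: dist_norm tendsto_norm_zero_iff tendsto_rabs_zero_iff)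
  have h_lim: "(\<lambda>j. h (u j)) \<longlonglongrightarrow> h z" if "u \<longlonglongrightarrow> z" for u :: "nat \<Rightarrow> 'a" and z
    using continuous_on_tendsto_compose[OF h_cont that] by simp
  obtain R where R: "R > 0" "\<And>k. norm (U k) \<le> R" using bounded_U by blast
  have one_step: "norm (Y (Suc k) - Y k) \<le> R * \<eta> k" for k
    using R(2)[of k] eta_pos[of k] by (simp add: Y_Suc U_def[symmetric] mult.commute)
  have move: "norm (Y l - Y k) \<le> R * (tm l - tm k)" if "k \<le> l" for k l
    using that
  proof (induction l rule: dec_induct)
    case (step n)
    then show ?case
      using one_step[of n] norm_triangle_ineq[of "Y (Suc n) - Y n" "Y n - Y k"]
      by (simp add: tm_Suc algebra_simps)
  qed simp
  have "(\<lambda>k. Y (Suc k) - Y k) \<longlonglongrightarrow> 0"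
    by (rule Lim_null_comparison[where g = "\<lambda>k. R * \<eta> k"])
       (use one_step in \<open>auto intro!: tendsto_mult_right_zero eta_lim\<close>)
  then have h_step: "(\<lambda>k. h (Y (Suc k)) - h (Y k)) \<longlonglongrightarrow> 0"
    by (intro h_close YB)
  have conv: "convergent (\<lambda>k. h (Y k))"
  proof (rule ccontr)
    assume nconv: "\<not> convergent (\<lambda>k. h (Y k))"
    define a where "a k = h (Y k)" for k
    have "bounded (range a)"
    proof -
      have "compact (h ` B)" unfolding B_def
        by (intro compact_continuous_image continuous_on_subset[OF h_cont]) auto
      then show ?thesis
        using bounded_subset[OF compact_imp_bounded] YB by (metis a_def image_subsetI imageI)
    qed
    obtain p q where pq: "p < q" "\<And>N. \<exists>k\<ge>N. a k \<le> p" "\<And>N. \<exists>k\<ge>N. q \<le> a k"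
      using oscillates_if_not_convergent[OF \<open>bounded (range a)\<close>] nconv unfolding a_def by blast
    have "\<not> {p<..<q} \<subseteq> h ` {x \<in> K. - b x \<in> S x}"
    proof
      assume "{p<..<q} \<subseteq> h ` {x \<in> K. - b x \<in> S x}"
      then have "{p<..<q} \<subseteq> interior (h ` {x \<in> K. - b x \<in> S x})" by (simp add: interior_maximal)
      then show False using sard dense[OF pq(1)] by auto
    qed
    then obtain r where r: "p < r" "r < q" "r \<notin> h ` {x \<in> K. - b x \<in> S x}"
      unfolding subset_iff greaterThanLessThan_iff by blast
    have "\<exists>k l. k \<ge> N \<and> k < l \<and> a k \<le> r \<and> (\<forall>i. k < i \<and> i \<le> l \<longrightarrow> r < a i) \<and> q \<le> a l" for N
    proof -
      obtain i where i: "i \<ge> N" "a i \<le> p" using pq(2) by blast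
      obtain l where l: "l \<ge> i" "q \<le> a l" using pq(3) by blast
      \<comment> \<open>The crossing starts at the last index before \<open>l\<close> at which the
        value is at most \<open>r\<close>.\<close>
      define A where "A = {k. i \<le> k \<and> k \<le> l \<and> a k \<le> r}"
      have A: "finite A" "i \<in> A" using i l r by (auto simp: A_def)
      define k where "k = Max A"
      have kA: "k \<in> A" unfolding k_def using A by (intro Max_in) auto
      have "r < a j" if "k < j" "j \<le> l" for j
      proof (rule ccontr)
        assume "\<not> r < a j"
        then have "j \<in> A" using that kA by (auto simp: A_def)
        then show False using Max_ge[OF A(1), of j] that by (simp add: k_def)
      qed
      moreover have "k < l" using kA l r by (cases "k = l") (auto simp: A_def)
      ultimately show ?thesis using kA i l by (intro exI[of _ k] exI[of _ l]) (auto simp: A_def)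
    qed
    then obtain \<kappa> \<mu> where \<kappa>: "\<And>N. \<kappa> N \<ge> N" "\<And>N. \<kappa> N < \<mu> N" "\<And>N. a (\<kappa> N) \<le> r"
      "\<And>N i. \<kappa> N < i \<Longrightarrow> i \<le> \<mu> N \<Longrightarrow> r < a i" "\<And>N. q \<le> a (\<mu> N)" by metis
    have "compact B" by (simp add: B_def)
    then obtain x\<^sub>0 s where s: "strict_mono s" "((\<lambda>N. Y (\<kappa> N)) \<circ> s) \<longlonglongrightarrow> x\<^sub>0"
      using seq_compactE[OF compact_imp_seq_compact, of B "\<lambda>N. Y (\<kappa> N)"] YB by metis
    define m where "m = \<kappa> \<circ> s"
    have Ym: "(\<lambda>j. Y (m j)) \<longlonglongrightarrow> x\<^sub>0" using s(2) by (simp add: m_def o_def)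
    have m: "filterlim m at_top sequentially"
      by (rule filterlim_at_top_mono[OF filterlim_subseq[OF s(1)]]) (simp add: m_def \<kappa>)
    have am: "(\<lambda>j. a (m j)) \<longlonglongrightarrow> h x\<^sub>0" unfolding a_def by (rule h_lim[OF Ym])
    \<comment> \<open>The values on the two sides of the crossing have the same limit, which forces
      \<open>h x\<^sub>0 = r\<close>.\<close>
    have "(\<lambda>j. h (Y (Suc (m j))) - h (Y (m j))) \<longlonglongrightarrow> 0"
      by (rule filterlim_compose[OF h_step m])
    from tendsto_add[OF this am] have amS: "(\<lambda>j. a (Suc (m j))) \<longlonglongrightarrow> h x\<^sub>0"
      by (simp add: a_def)
    have "h x\<^sub>0 \<le> r" by (rule LIMSEQ_le_const2[OF am]) (auto simp: m_def \<kappa>)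
    moreover have "r \<le> h x\<^sub>0"
    proof (rule LIMSEQ_le_const[OF amS], intro exI allI impI)
      show "r \<le> a (Suc (m j))" for j using \<kappa>(4)[of "s j" "Suc (m j)"] \<kappa>(2)[of "s j"] by (simp add: m_def)
    qed
    ultimately have hx0: "h x\<^sub>0 = r" by simp
    obtain d where d: "d > 0" "\<And>u v. u \<in> B \<Longrightarrow> v \<in> B \<Longrightarrow> norm (u - v) < d \<Longrightarrow> \<bar>h u - h v\<bar> < q - r"
      using uc r unfolding uniformly_continuous_on_def dist_norm real_norm_def
      by (metis diff_gt_0_iff_gt)
    \<comment> \<open>Within time \<open>T\<close> the iterates move by less than \<open>d\<close>,
      too little for \<open>h\<close> to rise from \<open>r\<close> to \<open>q\<close>. The
      crossing therefore lasts longer than \<open>T\<close>.\<close>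
    define T where "T = d / (2 * R)"
    have T: "T > 0" "R * T < d" using d R by (auto simp: T_def)
    have "- b x\<^sub>0 \<in> S x\<^sub>0"
    proof (rule stationary_if_no_descent[OF h_cont lyap m Ym T(1)])
      fix e :: real assume e: "e > 0"
      have "\<forall>\<^sub>F j in sequentially. a (m j) > h x\<^sub>0 - e"
        using order_tendstoD(1)[OF am, of "h x\<^sub>0 - e"] e by simp
      then show "\<forall>\<^sub>F j in sequentially. \<forall>k\<ge>m j. tm k \<le> tm (m j) + T \<longrightarrow> h x\<^sub>0 - e \<le> h (Y k)"
      proof eventually_elim
        case (elim j)
        show ?case
        proof (intro allI impI)
          fix k assume k: "k \<ge> m j" "tm k \<le> tm (m j) + T"
          have ml: "m j < \<mu> (s j)" using \<kappa>(2) by (simp add: m_def)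
          have "k < \<mu> (s j)"
          proof (rule ccontr)
            assume "\<not> ?thesis"
            then have "tm (\<mu> (s j)) \<le> tm (m j) + T" using mono_tm[of "\<mu> (s j)" k] k by simp
            then have "R * (tm (\<mu> (s j)) - tm (m j)) \<le> R * T" using R by (intro mult_left_mono) auto
            then have "norm (Y (\<mu> (s j)) - Y (m j)) < d"
              using move[of "m j" "\<mu> (s j)"] ml T by simp
            then have "a (\<mu> (s j)) - a (m j) < q - r"
              using d(2)[OF YB YB] by (fastforce simp: a_def)
            then show False using \<kappa>(5)[of "s j"] \<kappa>(3)[of "s j"] by (simp add: m_def)
          qed
          \<comment> \<open>Only the starting index itself may lie below \<open>r\<close>; there
            convergence to \<open>h x\<^sub>0\<close> gives the bound up to
            \<open>e\<close>.\<close>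
          then have "k = m j \<or> r < a k" 
            using \<kappa>(4)[of "s j" k] k(1) unfolding m_def comp_apply by linarith
          then show "h x\<^sub>0 - e \<le> h (Y k)" using elim hx0 e by (auto simp: a_def)
        qed
      qed
    qed
    moreover have "x\<^sub>0 \<in> K"
    proof -
      have "(\<lambda>j. Y (m j) - (Y (m j) - X (m j))) \<longlonglongrightarrow> x\<^sub>0 - 0"
        by (intro tendsto_diff Ym filterlim_compose[OF Y_diff_X m])
      then have "(\<lambda>j. X (m j)) \<longlonglongrightarrow> x\<^sub>0" by simp
      then show ?thesis
        using closed_sequentially[OF compact_imp_closed[OF compact_K], of "\<lambda>j. X (m j)"] X_in_K by blast
    qed
    ultimately show False using r(3) hx0 by blast
  qed
  then obtain H where H: "(\<lambda>k. h (Y k)) \<longlonglongrightarrow> H" by (auto simp: convergent_def)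
  from tendsto_diff[OF H h_close[OF YB XB Y_diff_X]] show "convergent (\<lambda>k. h (X k))"
    by (auto simp: convergent_def)
  assume r: "strict_mono r" "(\<lambda>j. X (r j)) \<longlonglongrightarrow> x"
  have rl: "filterlim r at_top sequentially" by (rule filterlim_subseq[OF r(1)])
  from tendsto_add[OF r(2) filterlim_compose[OF Y_diff_X rl]]
  have Yr: "(\<lambda>j. Y (r j)) \<longlonglongrightarrow> x" by simp
  have hx: "h x = H"
    using LIMSEQ_unique[OF h_lim[OF Yr] filterlim_compose[OF H rl]] .
  show "- b x \<in> S x"
  proof (rule stationary_if_no_descent[OF h_cont lyap rl Yr zero_less_one])
    fix e :: real assume e: "e > 0"
    have "\<forall>\<^sub>F k in sequentially. h (Y k) > H - e"
      using order_tendstoD(1)[OF H, of "H - e"] e by simp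
    then obtain N where N: "\<And>k. k \<ge> N \<Longrightarrow> h (Y k) > H - e" by (auto simp: eventually_sequentially)
    have "\<forall>\<^sub>F j in sequentially. r j \<ge> N" using rl by (simp add: filterlim_at_top)
    then show "\<forall>\<^sub>F j in sequentially. \<forall>k\<ge>r j. tm k \<le> tm (r j) + 1 \<longrightarrow> h x - e \<le> h (Y k)"
      by eventually_elim (use N hx in \<open>auto intro!: less_imp_le\<close>)
  qed
qed

end

section \<open>Potentials along Lipschitz curves\<close>

lemma lipschitz_imp_abs_continuous_on:
  assumes lip: "L-lipschitz_on S \<gamma>"
  shows "abs_continuous_on S \<gamma>"
  unfolding abs_continuous_on_def
proof (intro allI impI)
  fix \<epsilon> :: real assume \<epsilon>: "\<epsilon> > 0"
  have L: "L \<ge> 0" using lip by (rule lipschitz_on_nonneg)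
  show "\<exists>\<delta>>0. \<forall>d T. d division_of T \<and> T \<subseteq> S \<and> (\<Sum>k\<in>d. Sup k - Inf k) < \<delta> \<longrightarrow>
        (\<Sum>k\<in>d. norm (\<gamma> (Sup k) - \<gamma> (Inf k))) < \<epsilon>"
  proof (intro exI[of _ "\<epsilon> / (L + 1)"] conjI allI impI)
    show "\<epsilon> / (L + 1) > 0" using \<epsilon> L by simp
    fix d T
    assume d: "d division_of T \<and> T \<subseteq> S \<and> (\<Sum>k\<in>d. Sup k - Inf k) < \<epsilon> / (L + 1)"
    have "norm (\<gamma> (Sup k) - \<gamma> (Inf k)) \<le> L * (Sup k - Inf k)" if kd: "k \<in> d" for k
    proof -
      have div: "d division_of T" using d by blast
      obtain a b where "k = cbox a b" using division_ofD(4)[OF div kd] by blast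
      then have k: "k = {a..b}" "k \<noteq> {}" "k \<subseteq> T"
        using division_ofD(2,3)[OF div kd] by simp_all
      then have ab: "a \<le> b" by simp
      then have "a \<in> S" "b \<in> S" using k d by auto
      then show ?thesis using lipschitz_onD[OF lip, of b a] ab by (simp add: k dist_norm)
    qed
    then have "(\<Sum>k\<in>d. norm (\<gamma> (Sup k) - \<gamma> (Inf k))) \<le> (\<Sum>k\<in>d. L * (Sup k - Inf k))"
      by (rule sum_mono)
    also have "\<dots> = L * (\<Sum>k\<in>d. Sup k - Inf k)" by (simp add: sum_distrib_left)
    also have "\<dots> \<le> L * (\<epsilon> / (L + 1))" using L d by (intro mult_left_mono) auto
    also have "\<dots> < \<epsilon>" using L \<epsilon> by (simp add: field_simps)
    finally show "(\<Sum>k\<in>d. norm (\<gamma> (Sup k) - \<gamma> (Inf k))) < \<epsilon>" .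
  qed
qed

lemma difference_quotient_LIMSEQ:
  assumes "(\<psi> has_real_derivative d) (at t)"
  shows "(\<lambda>n. (\<psi> (t + inverse (real (Suc n))) - \<psi> t) / inverse (real (Suc n))) \<longlonglongrightarrow> d"
proof -
  have "filterlim (\<lambda>n. inverse (real (Suc n))) (at 0) sequentially"
    by (rule filterlim_atI[OF LIMSEQ_inverse_real_of_nat]) auto
  then show ?thesis
    using filterlim_compose[OF assms[unfolded DERIV_def]] by blast
qed

text \<open>Difference quotients of a Lipschitz function are bounded by \<open>L\<close> and
  converge almost everywhere to the derivative, so dominated convergence applies to their integrals.
  These are also increments of difference quotients of an antiderivative, hence tend to
  \<open>\<psi> 1 - \<psi> 0\<close>.\<close>

lemma lipschitz_increment_le_integral:
  fixes \<psi> g :: "real \<Rightarrow> real"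
  assumes lip: "L-lipschitz_on UNIV \<psi>"
    and deriv: "AE t in lebesgue_on {0..1}. \<exists>d. (\<psi> has_real_derivative d) (at t) \<and> d \<le> g t"
    and g: "integrable (lebesgue_on {0..1}) g"
  shows "\<psi> 1 - \<psi> 0 \<le> (LINT t|lebesgue_on {0..1}. g t)"
proof -
  define e where "e n = inverse (real (Suc n))" for n
  have e: "e n > 0" "e n \<le> 1" for n by (auto simp: e_def inverse_le_1_iff)
  define q where "q n t = (\<psi> (t + e n) - \<psi> t) / e n" for n t
  have cont: "continuous_on A \<psi>" for A
    using lipschitz_on_continuous_on[OF lip] continuous_on_subset by blast
  have cont_q: "continuous_on {0..1} (q n)" for n
    unfolding q_def using e[of n]
    by (intro continuous_intros continuous_on_compose2[OF cont[of UNIV]]) auto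
  \<comment> \<open>The larger interval keeps every shifted point \<open>t + e n \<le> 2\<close> in
    its interior.\<close>
  obtain \<Psi> where \<Psi>: "\<And>x. x \<in> {-1..3} \<Longrightarrow> (\<Psi> has_vector_derivative \<psi> x) (at x within {-1..3})"
    using antiderivative_continuous[OF cont] by blast
  have \<Psi>_at: "(\<Psi> has_real_derivative \<psi> x) (at x)" if "x \<in> {-1<..<3}" for x
    using \<Psi>[of x] that at_within_interior[of x "{-1..3}"]
    by (simp add: has_real_derivative_iff_has_vector_derivative)
  define Q where "Q n t = (\<Psi> (t + e n) - \<Psi> t) / e n" for n t
  have "(q n has_integral (Q n 1 - Q n 0)) {0..1}" for n
  proof (rule fundamental_theorem_of_calculus)
    fix x :: real assume x: "x \<in> {0..1}"
    have "((\<lambda>t. \<Psi> (t + e n)) has_real_derivative \<psi> (x + e n)) (at x)"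
      using \<Psi>_at[of "x + e n"] x e[of n] by (simp add: DERIV_shift)
    then have "(Q n has_real_derivative q n x) (at x)"
      unfolding Q_def q_def using \<Psi>_at[of x] x e[of n]
      by (intro DERIV_cdivide DERIV_diff) auto
    then show "(Q n has_vector_derivative q n x) (at x within {0..1})"
      by (simp add: has_real_derivative_iff_has_vector_derivative has_vector_derivative_at_within)
  qed simp
  then have int_q: "(LINT t|lebesgue_on {0..1}. q n t) = Q n 1 - Q n 0" for n
    using lebesgue_integral_eq_integral[OF continuous_imp_integrable_real[OF cont_q]]
    by (simp add: integral_unique)
  have "(\<lambda>n. Q n x) \<longlonglongrightarrow> \<psi> x" if "x \<in> {0..1}" for x
    using difference_quotient_LIMSEQ[OF \<Psi>_at[of x]] that by (simp add: Q_def e_def)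
  then have lim1: "(\<lambda>n. LINT t|lebesgue_on {0..1}. q n t) \<longlonglongrightarrow> \<psi> 1 - \<psi> 0"
    unfolding int_q by (intro tendsto_diff) auto
  \<comment> \<open>Taking \<open>lim\<close> at every time gives a measurable function, which is
    the derivative wherever that exists.\<close>
  define D where "D t = lim (\<lambda>n. q n t)" for t
  have q_meas: "q n \<in> borel_measurable (lebesgue_on {0..1})" for n
    by (intro continuous_imp_measurable_on_sets_lebesgue cont_q) auto
  have D_meas: "D \<in> borel_measurable (lebesgue_on {0..1})"
    unfolding D_def by (intro borel_measurable_lim_metric q_meas)
  have q_lim: "(\<lambda>n. q n t) \<longlonglongrightarrow> d" if "(\<psi> has_real_derivative d) (at t)" for t d
    using difference_quotient_LIMSEQ[OF that] by (simp add: q_def e_def)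
  have q_le: "norm (q n t) \<le> L" for n t
    using lipschitz_onD[OF lip, of "t + e n" t] e[of n] by (simp add: q_def dist_norm field_simps)
  have AE_lim: "AE t in lebesgue_on {0..1}. (\<lambda>n. q n t) \<longlonglongrightarrow> D t"
    using deriv by eventually_elim (auto simp: D_def dest!: q_lim simp: limI)
  have AE_le: "AE t in lebesgue_on {0..1}. D t \<le> g t"
    using deriv by eventually_elim (auto simp: D_def dest!: q_lim simp: limI)
  have L_int: "integrable (lebesgue_on {0..1}) (\<lambda>t::real. L)"
    by (rule continuous_imp_integrable_real) (rule continuous_on_const)
  have AE_bd: "AE t in lebesgue_on {0..1}. norm (q n t) \<le> L" for n
    using q_le by (rule AE_I2)
  note dc = D_meas q_meas L_int AE_lim AE_bd
  have lim2: "(\<lambda>n. LINT t|lebesgue_on {0..1}. q n t) \<longlonglongrightarrow> (LINT t|lebesgue_on {0..1}. D t)"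
    by (rule integral_dominated_convergence[OF dc])
  have D_int: "integrable (lebesgue_on {0..1}) D"
    by (rule integrable_dominated_convergence[OF dc])
  have "\<psi> 1 - \<psi> 0 = (LINT t|lebesgue_on {0..1}. D t)" by (rule LIMSEQ_unique[OF lim1 lim2])
  also have "\<dots> \<le> (LINT t|lebesgue_on {0..1}. g t)" by (rule integral_mono_AE[OF D_int g AE_le])
  finally show ?thesis .
qed

text \<open>The mean value inequality on a ball. As continuity is assumed for each direction
  separately, the operator norm is bounded through the images of the basis vectors.\<close>

lemma has_derivative_lipschitz_on_bounded:
  fixes F :: "'a::euclidean_space \<Rightarrow> 'b::real_normed_vector"
  assumes deriv: "\<And>x. (F has_derivative J x) (at x)"
    and cont: "\<And>v. continuous_on UNIV (\<lambda>x. J x v)"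
    and "bounded B"
  shows "\<exists>L. L-lipschitz_on B F"
proof -
  obtain r where r: "B \<subseteq> cball 0 r" using \<open>bounded B\<close> unfolding bounded_iff subset_iff mem_cball_0 by blast
  have "\<exists>C. \<forall>x\<in>cball 0 r. norm (J x i) \<le> C" for i
  proof -
    have "compact ((\<lambda>x. J x i) ` cball 0 r)"
      by (intro compact_continuous_image continuous_on_subset[OF cont]) auto
    then show ?thesis using compact_imp_bounded[of "(\<lambda>x. J x i) ` cball 0 r"] unfolding bounded_iff by blast
  qed
  then obtain C where C: "\<And>i x. x \<in> cball 0 r \<Longrightarrow> norm (J x i) \<le> C i" by metis
  define L where "L = (\<Sum>i\<in>Basis. \<bar>C i\<bar>)"
  have J: "norm (J x v) \<le> L * norm v" if x: "x \<in> cball 0 r" for x v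
  proof -
    have lin: "linear (J x)" using deriv has_derivative_linear by blast
    have "J x v = (\<Sum>i\<in>Basis. (v \<bullet> i) *\<^sub>R J x i)"
      by (subst euclidean_representation[of v, symmetric])
         (simp add: linear_sum[OF lin] linear_scale[OF lin] o_def del: euclidean_representation)
    also have "norm \<dots> \<le> (\<Sum>i\<in>Basis. norm v * \<bar>C i\<bar>)"
    proof (rule sum_norm_le)
      fix i :: 'a assume "i \<in> Basis"
      then show "norm ((v \<bullet> i) *\<^sub>R J x i) \<le> norm v * \<bar>C i\<bar>"
        using C[OF x, of i] Basis_le_norm[of i v] by (auto intro!: mult_mono)
    qed
    also have "\<dots> = L * norm v" by (simp add: L_def sum_distrib_left mult.commute)
    finally show ?thesis .
  qed
  have "L-lipschitz_on (cball 0 r) F"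
  proof (rule lipschitz_onI)
    fix x y :: 'a assume xy: "x \<in> cball 0 r" "y \<in> cball 0 r"
    have "norm (F x - F y) \<le> L * norm (x - y)"
    proof (rule differentiable_bound[OF convex_cball _ _ xy])
      show "(F has_derivative J z) (at z within cball 0 r)" for z
        by (rule has_derivative_at_withinI[OF deriv])
      show "onorm (J z) \<le> L" if "z \<in> cball 0 r" for z
        by (rule onorm_le) (rule J[OF that])
    qed
    then show "dist (F x) (F y) \<le> L * dist x y" by (simp add: dist_norm)
  qed (simp add: L_def sum_nonneg)
  then show ?thesis using lipschitz_on_subset[OF _ r] by blast
qed

lemma inner_between_min_max_speed:
  assumes "compact (D (\<gamma> t))" and u: "u \<in> D (\<gamma> t)"
  shows "min_speed D \<gamma> t \<le> vector_derivative \<gamma> (at t within {0..1}) \<bullet> u"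
    and "vector_derivative \<gamma> (at t within {0..1}) \<bullet> u \<le> max_speed D \<gamma> t"
proof -
  let ?f = "\<lambda>v. vector_derivative \<gamma> (at t within {0..1}) \<bullet> v"
  have "compact (?f ` D (\<gamma> t))"
    by (intro compact_continuous_image assms continuous_intros)
  then have bdd: "bdd_above (?f ` D (\<gamma> t))" "bdd_below (?f ` D (\<gamma> t))"
    by (auto dest: compact_imp_bounded bounded_imp_bdd_above bounded_imp_bdd_below)
  show "min_speed D \<gamma> t \<le> ?f u" unfolding min_speed_def by (rule cINF_lower[OF bdd(2) u])
  show "?f u \<le> max_speed D \<gamma> t" unfolding max_speed_def by (rule cSUP_upper[OF u bdd(1)])
qed

text \<open>Both integrals equal the increment of \<open>f\<close>, and the integrands are ordered,
  so they agree almost everywhere. Any element of the field may then be used to differentiate the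
  potential along the curve.\<close>

lemma potential_max_eq_min_speed:
  assumes cons: "conservative_field D" and pot: "admits_potential D f"
    and ac: "abs_continuous_on {0..1} \<gamma>"
  shows "AE t in lebesgue_on {0..1}. max_speed D \<gamma> t = min_speed D \<gamma> t"
proof -
  let ?M = "lebesgue_on {0..1::real}"
  have int: "integrable ?M (max_speed D \<gamma>)" "integrable ?M (min_speed D \<gamma>)"
    and "(LINT t|?M. max_speed D \<gamma> t) = (LINT t|?M. min_speed D \<gamma> t)"
    using pot[unfolded admits_potential_def, rule_format, of \<gamma> "\<gamma> 0" "\<gamma> 1"] ac by simp_all
  then have "(LINT t|?M. max_speed D \<gamma> t - min_speed D \<gamma> t) = 0" by simp
  moreover have "min_speed D \<gamma> t \<le> max_speed D \<gamma> t" for t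
  proof -
    obtain u where "u \<in> D (\<gamma> t)" using cons unfolding conservative_field_def by blast
    then show ?thesis
      using inner_between_min_max_speed[of D \<gamma> t u] cons unfolding conservative_field_def by force
  qed
  ultimately have "AE t in ?M. max_speed D \<gamma> t - min_speed D \<gamma> t = 0"
    using integral_nonneg_eq_0_iff_AE[of ?M "\<lambda>t. max_speed D \<gamma> t - min_speed D \<gamma> t"] int by simp
  then show ?thesis by simp
qed

text \<open>The chain rule asserts that the curve itself has a derivative at almost every time.
  Dropping the two end points makes this derivative two-sided.\<close>

lemma path_differentiable_imp_AE_differentiable:
  fixes f :: "'a::euclidean_space \<Rightarrow> real" and \<gamma> :: "real \<Rightarrow> 'a"
  assumes "path_differentiable f" and lip: "L-lipschitz_on UNIV \<gamma>"
  shows "AE t in lebesgue_on {0..1}. 0 < t \<and> t < 1 \<and> (\<exists>v. (\<gamma> has_vector_derivative v) (at t))"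
proof -
  have "abs_continuous_on {0..} \<gamma>"
    by (rule lipschitz_imp_abs_continuous_on[OF lipschitz_on_subset[OF lip]]) simp
  then have 1: "AE t in lebesgue. 0 \<le> t \<longrightarrow> (\<exists>v. (\<gamma> has_vector_derivative v) (at t within {0..}))"
    using assms(1)[unfolded path_differentiable_def, rule_format, of \<gamma>]
    by (auto elim!: AE_mp)
  have 2: "AE t in lebesgue. t \<noteq> (0::real)" "AE t in lebesgue. t \<noteq> (1::real)"
    by (auto intro!: AE_completion AE_lborel_singleton)
  have "AE t in lebesgue. t \<in> {0..1} \<longrightarrow> 0 < t \<and> t < 1 \<and> (\<exists>v. (\<gamma> has_vector_derivative v) (at t))"
    using 1 2
  proof eventually_elim
    case (elim t)
    have "at t within {0..} = at t" if "0 < t"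
      using that by (intro at_within_interior) simp
    then show ?case using elim by force
  qed
  then show ?thesis
    by (rule AE_restrict_space_iff[THEN iffD2, rotated]) simp
qed

text \<open>For \<open>w = \<gamma> T - \<gamma> 0\<close>, integrating \<open>\<parallel>\<gamma>'\<parallel>\<^sup>2 \<ge> 2 (w \<bullet> \<gamma>') / T - \<parallel>w\<parallel>\<^sup>2 / T\<^sup>2\<close> gives the
  bound \<open>\<integral>\<parallel>\<gamma>'\<parallel>\<^sup>2 \<ge> \<parallel>w\<parallel>\<^sup>2 / T\<close> on the decrease.\<close>

lemma lyapunov_descent:
  fixes f q :: "'a::euclidean_space \<Rightarrow> real" and A :: "'a \<Rightarrow> 'a"
  assumes path: "path_differentiable f"
    and cons: "conservative_field D" and pot: "admits_potential D f"
    and A: "\<And>x. (A has_derivative J x) (at x)"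
    and A_lip: "\<And>B. bounded B \<Longrightarrow> \<exists>L. L-lipschitz_on B A"
    and J_sym: "\<And>x u v. J x u \<bullet> v = u \<bullet> J x v"
    and q: "\<And>x. (q has_derivative (\<lambda>v. b x \<bullet> v)) (at x)"
    and q_lip: "\<And>B. bounded B \<Longrightarrow> \<exists>L. L-lipschitz_on B q"
    and T: "T > 0"
    and lip: "L-lipschitz_on {0..T} \<gamma>"
    and incl: "\<And>t v. 0 < t \<Longrightarrow> t < T \<Longrightarrow> (\<gamma> has_vector_derivative v) (at t) \<Longrightarrow>
        - v - b (\<gamma> t) \<in> J (\<gamma> t) ` D (A (\<gamma> t))"
  shows "f (A (\<gamma> T)) + q (\<gamma> T) \<le> f (A (\<gamma> 0)) + q (\<gamma> 0) - (norm (\<gamma> T - \<gamma> 0))\<^sup>2 / T"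
proof -
  let ?M = "lebesgue_on {0..1::real}"
  \<comment> \<open>Time is rescaled to the unit interval, and the curve is frozen outside it to be
    Lipschitz on the whole line.\<close>
  define \<delta> where "\<delta> t = \<gamma> (T * max 0 (min 1 t))" for t
  define w where "w = \<gamma> T - \<gamma> 0"
  have clamp: "T * max 0 (min 1 t) \<in> {0..T}" for t using T by auto
  have \<delta>_lip: "(L * T)-lipschitz_on UNIV \<delta>"
  proof (rule lipschitz_onI)
    fix s t :: real
    have "dist (\<delta> s) (\<delta> t) \<le> L * dist (T * max 0 (min 1 s)) (T * max 0 (min 1 t))"
      unfolding \<delta>_def by (rule lipschitz_onD[OF lip clamp clamp])
    also have "dist (T * max 0 (min 1 s)) (T * max 0 (min 1 t)) = T * \<bar>max 0 (min 1 s) - max 0 (min 1 t)\<bar>"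
      using T by (simp add: dist_real_def right_diff_distrib[symmetric] abs_mult)
    also have "L * (T * \<bar>max 0 (min 1 s) - max 0 (min 1 t)\<bar>) \<le> L * (T * dist s t)"
      using T lipschitz_on_nonneg[OF lip] by (intro mult_left_mono) (auto simp: dist_real_def)
    finally show "dist (\<delta> s) (\<delta> t) \<le> L * T * dist s t" by (simp add: mult.assoc)
  qed (use T lipschitz_on_nonneg[OF lip] in simp)
  have "continuous_on {0..T} \<gamma>" by (rule lipschitz_on_continuous_on[OF lip])
  then have "bounded (\<gamma> ` {0..T})" by (intro compact_imp_bounded compact_continuous_image compact_Icc)
  then have bd: "bounded (range \<delta>)"
    by (rule bounded_subset) (use clamp in \<open>auto simp: \<delta>_def\<close>)
  obtain LA where LA: "LA-lipschitz_on (range \<delta>) A" using A_lip[OF bd] by blast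
  obtain Lq where Lq: "Lq-lipschitz_on (range \<delta>) q" using q_lip[OF bd] by blast
  define \<alpha> where "\<alpha> t = A (\<delta> t)" for t
  have "(LA * (L * T))-lipschitz_on UNIV \<alpha>"
    unfolding \<alpha>_def by (rule lipschitz_on_compose2[OF \<delta>_lip LA])
  then have ac: "abs_continuous_on {0..1} \<alpha>"
    by (rule lipschitz_imp_abs_continuous_on[OF lipschitz_on_subset]) simp
  have int: "integrable ?M (max_speed D \<alpha>)" and "f (\<alpha> 1) = f (\<alpha> 0) + (LINT t|?M. max_speed D \<alpha> t)"
    using pot[unfolded admits_potential_def, rule_format, of \<alpha> "\<alpha> 0" "\<alpha> 1"] ac by simp_all
  then have fdiff: "f (\<alpha> 0) - f (\<alpha> 1) = (LINT t|?M. - max_speed D \<alpha> t)" by simp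
  \<comment> \<open>In rescaled time \<open>v\<close> is \<open>T\<close> times the velocity of
    \<open>\<gamma>\<close>, and the last two terms have derivative
    \<open>2 (w \<bullet> v) / T - (norm w)\<^sup>2 / T\<close>, at most
    \<open>(v \<bullet> v) / T\<close>.\<close>
  define \<psi> where "\<psi> t = q (\<delta> t) + (2 / T) * (w \<bullet> \<delta> t) - (norm w)\<^sup>2 / T * t" for t
  have "\<exists>L'. L'-lipschitz_on UNIV \<psi>"
  proof -
    have 1: "(Lq * (L * T))-lipschitz_on UNIV (\<lambda>t. q (\<delta> t))"
      by (rule lipschitz_on_compose2[OF \<delta>_lip Lq])
    have "bounded_linear (\<lambda>x. (2 / T) * (w \<bullet> x))"
      by (intro bounded_linear_intros)
    then obtain C where "C-lipschitz_on (range \<delta>) (\<lambda>x. (2 / T) * (w \<bullet> x))"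
      using bounded_linear.lipschitz_boundE by blast
    then have 2: "(C * (L * T))-lipschitz_on UNIV (\<lambda>t. (2 / T) * (w \<bullet> \<delta> t))"
      by (rule lipschitz_on_compose2[OF \<delta>_lip])
    have "bounded_linear (\<lambda>t::real. (norm w)\<^sup>2 / T * t)" by (rule bounded_linear_mult_right)
    then obtain E where 3: "E-lipschitz_on UNIV (\<lambda>t::real. (norm w)\<^sup>2 / T * t)"
      using bounded_linear.lipschitz_boundE by blast
    show ?thesis unfolding \<psi>_def using lipschitz_on_diff[OF lipschitz_on_add[OF 1 2] 3] by blast
  qed
  then obtain L' where \<psi>_lip: "L'-lipschitz_on UNIV \<psi>" by blast
  have "AE t in ?M. \<exists>d. (\<psi> has_real_derivative d) (at t) \<and> d \<le> - max_speed D \<alpha> t"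
    using path_differentiable_imp_AE_differentiable[OF path \<delta>_lip]
      potential_max_eq_min_speed[OF cons pot ac]
  proof eventually_elim
    case (elim t)
    then obtain v where t: "0 < t" "t < 1" and v: "(\<delta> has_vector_derivative v) (at t)" by blast
    have "((\<lambda>s. \<delta> (s / T)) has_vector_derivative (1 / T) *\<^sub>R v) (at (T * t))"
    proof -
      have "((\<lambda>s. s / T) has_real_derivative 1 / T) (at (T * t))"
        using T by (auto intro!: derivative_eq_intros)
      moreover have "(\<delta> has_vector_derivative v) (at (T * t / T))" using v T by simp
      ultimately show ?thesis
        using vector_diff_chain_at[of "\<lambda>s. s / T" "1 / T" "T * t" \<delta> v]
        by (simp add: has_real_derivative_iff_has_vector_derivative o_def)
    qed
    then have "(\<gamma> has_vector_derivative (1 / T) *\<^sub>R v) (at (T * t))"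
    proof (rule has_vector_derivative_transform_within_open[where S = "{0<..<T}"])
      show "\<delta> (s / T) = \<gamma> s" if "s \<in> {0<..<T}" for s
        using that T by (simp add: \<delta>_def)
    qed (use t T in auto)
    moreover have \<gamma>_eq: "\<gamma> (T * t) = \<delta> t" using t by (simp add: \<delta>_def)
    ultimately obtain u where u: "u \<in> D (\<alpha> t)" "- (1 / T) *\<^sub>R v - b (\<delta> t) = J (\<delta> t) u"
      using incl[of "T * t" "(1 / T) *\<^sub>R v"] t T by (auto simp: \<alpha>_def)
    have v': "(\<delta> has_derivative (\<lambda>h. h *\<^sub>R v)) (at t)" using v by (simp add: has_vector_derivative_def)
    have lin: "linear (J (\<delta> t))" using A has_derivative_linear by blast
    have "(\<alpha> has_derivative (\<lambda>h. J (\<delta> t) (h *\<^sub>R v))) (at t)"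
      unfolding \<alpha>_def by (rule has_derivative_compose[OF v' A])
    then have "(\<alpha> has_vector_derivative J (\<delta> t) v) (at t)"
      by (simp add: has_vector_derivative_def linear_scale[OF lin])
    then have "(\<alpha> has_vector_derivative J (\<delta> t) v) (at t within {0..1})"
      by (rule has_vector_derivative_at_within)
    then have vd: "vector_derivative \<alpha> (at t within {0..1}) = J (\<delta> t) v"
      using t by (intro vector_derivative_within_cbox[of 0 1, unfolded box_real]) auto
    \<comment> \<open>Equality of maximum and minimum fixes the inner product with the particular
      \<open>u\<close> from the inclusion. Symmetry then moves \<open>J\<close> onto
      \<open>u\<close>, where its value is known.\<close>
    have "max_speed D \<alpha> t = J (\<delta> t) v \<bullet> u"
      using inner_between_min_max_speed[of D \<alpha> t u] u(1) elim(2) cons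
      by (simp add: vd conservative_field_def order_antisym)
    also have "\<dots> = v \<bullet> (- (1 / T) *\<^sub>R v - b (\<delta> t))" by (simp only: J_sym u(2))
    also have "\<dots> = - (v \<bullet> v) / T - b (\<delta> t) \<bullet> v" by (simp add: inner_diff_right inner_commute)
    finally have ms: "- max_speed D \<alpha> t = (v \<bullet> v) / T + b (\<delta> t) \<bullet> v" by simp
    have "((\<lambda>t. q (\<delta> t)) has_derivative (\<lambda>h. b (\<delta> t) \<bullet> (h *\<^sub>R v))) (at t)"
      by (rule has_derivative_compose[OF v' q])
    then have 1: "((\<lambda>t. q (\<delta> t)) has_real_derivative b (\<delta> t) \<bullet> v) (at t)"
      unfolding has_field_derivative_def by (rule has_derivative_eq_rhs) (simp add: fun_eq_iff)
    have "((\<lambda>t. w \<bullet> \<delta> t) has_derivative (\<lambda>h. w \<bullet> (h *\<^sub>R v))) (at t)"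
      by (rule has_derivative_inner_right[OF v'])
    then have 2: "((\<lambda>t. w \<bullet> \<delta> t) has_real_derivative w \<bullet> v) (at t)"
      unfolding has_field_derivative_def by (rule has_derivative_eq_rhs) (simp add: fun_eq_iff)
    have "(\<psi> has_real_derivative b (\<delta> t) \<bullet> v + (2 / T) * (w \<bullet> v) - (norm w)\<^sup>2 / T) (at t)"
      unfolding \<psi>_def by (rule derivative_eq_intros 1 2 refl)+ simp
    moreover have "(2 / T) * (w \<bullet> v) - (norm w)\<^sup>2 / T \<le> (v \<bullet> v) / T"
    proof -
      have "0 \<le> (w - v) \<bullet> (w - v)" by (rule inner_ge_zero)
      then have "2 * (w \<bullet> v) - (norm w)\<^sup>2 \<le> v \<bullet> v"
        by (simp add: power2_norm_eq_inner inner_diff_left inner_diff_right inner_commute)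
      then have "(2 * (w \<bullet> v) - (norm w)\<^sup>2) / T \<le> (v \<bullet> v) / T" using T by (intro divide_right_mono) auto
      then show ?thesis by (simp add: diff_divide_distrib)
    qed
    ultimately show ?case unfolding ms by (intro exI[of _ "b (\<delta> t) \<bullet> v + (2 / T) * (w \<bullet> v) - (norm w)\<^sup>2 / T"] conjI) linarith+
  qed
  then have "\<psi> 1 - \<psi> 0 \<le> f (\<alpha> 0) - f (\<alpha> 1)"
    unfolding fdiff by (rule lipschitz_increment_le_integral[OF \<psi>_lip _ integrable_minus[OF int]])
  moreover have "\<psi> 1 - \<psi> 0 = q (\<gamma> T) - q (\<gamma> 0) + (norm w)\<^sup>2 / T"
  proof -
    have "(2 / T) * (w \<bullet> \<gamma> T) - (2 / T) * (w \<bullet> \<gamma> 0) = 2 * ((norm w)\<^sup>2 / T)"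
      by (simp add: w_def power2_norm_eq_inner inner_diff_right diff_divide_distrib)
    then show ?thesis by (simp add: \<psi>_def \<delta>_def)
  qed
  ultimately show ?thesis by (simp add: \<alpha>_def \<delta>_def w_def)
qed

section \<open>Frobenius geometry near the Stiefel manifold\<close>

lemma inner_transpose_transpose:
  fixes A B :: "real^'n^'m"
  shows "transpose A \<bullet> transpose B = A \<bullet> B"
  unfolding inner_vec_def transpose_def by (simp add: sum.swap[of _ "UNIV :: 'm set"])

lemma norm_transpose:
  fixes A :: "real^'n^'m"
  shows "norm (transpose A) = norm A"
  by (simp add: norm_eq_sqrt_inner inner_transpose_transpose)

lemma inner_matrix_mult_right:
  fixes A :: "real^'k^'m" and B :: "real^'n^'k" and C :: "real^'n^'m"
  shows "(A ** B) \<bullet> C = A \<bullet> (C ** transpose B)"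
proof -
  have "(\<Sum>j\<in>UNIV. (\<Sum>k\<in>UNIV. A $ i $ k * B $ k $ j) * C $ i $ j) =
        (\<Sum>k\<in>UNIV. A $ i $ k * (\<Sum>j\<in>UNIV. C $ i $ j * B $ k $ j))" for i
    unfolding sum_distrib_left sum_distrib_right
    by (subst sum.swap) (simp add: mult_ac)
  then show ?thesis
    by (simp add: inner_vec_def matrix_matrix_mult_def transpose_def)
qed

lemma inner_matrix_mult_left:
  fixes A :: "real^'k^'m" and B :: "real^'n^'k" and C :: "real^'n^'m"
  shows "(A ** B) \<bullet> C = B \<bullet> (transpose A ** C)"
proof -
  have "(A ** B) \<bullet> C = (transpose B ** transpose A) \<bullet> transpose C"
    by (simp add: inner_transpose_transpose flip: matrix_transpose_mul)
  also have "\<dots> = transpose B \<bullet> transpose (transpose A ** C)"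
    by (simp add: inner_matrix_mult_right matrix_transpose_mul)
  finally show ?thesis by (simp add: inner_transpose_transpose)
qed

lemma norm_matrix_mult_le:
  fixes A :: "real^'k^'m" and B :: "real^'n^'k"
  shows "norm (A ** B) \<le> norm A * norm B"
proof -
  have sq: "(norm M)\<^sup>2 = (\<Sum>i\<in>UNIV. (norm (M $ i))\<^sup>2)" for M :: "real^'c^'d"
    unfolding power2_norm_eq_inner by (simp add: inner_vec_def)
  have entry: "((A ** B) $ i $ j)\<^sup>2 \<le> (norm (A $ i))\<^sup>2 * (norm (transpose B $ j))\<^sup>2" for i j
  proof -
    have "(A ** B) $ i $ j = A $ i \<bullet> transpose B $ j"
      by (simp add: matrix_matrix_mult_def inner_vec_def transpose_def)
    then show ?thesis using Cauchy_Schwarz_ineq[of "A $ i" "transpose B $ j"]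
      by (simp add: power2_norm_eq_inner)
  qed
  have "(norm (A ** B))\<^sup>2 = (\<Sum>i\<in>UNIV. \<Sum>j\<in>UNIV. ((A ** B) $ i $ j)\<^sup>2)"
    unfolding sq unfolding power2_norm_eq_inner by (simp add: inner_vec_def power2_eq_square)
  also have "\<dots> \<le> (\<Sum>i\<in>UNIV. \<Sum>j\<in>UNIV. (norm (A $ i))\<^sup>2 * (norm (transpose B $ j))\<^sup>2)"
    by (intro sum_mono entry)
  also have "\<dots> = (norm A)\<^sup>2 * (norm (transpose B))\<^sup>2"
    unfolding sq by (simp add: sum_product)
  also have "\<dots> = (norm A * norm B)\<^sup>2" by (simp add: norm_transpose power_mult_distrib)
  finally show ?thesis by (rule power2_le_imp_le) simp
qed

lemma bounded_bilinear_matrix_mult: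
  "bounded_bilinear ((**) :: real^'k^'m \<Rightarrow> real^'n^'k \<Rightarrow> real^'n^'m)"
proof
  show "\<exists>K. \<forall>(A::real^'k^'m) (B::real^'n^'k). norm (A ** B) \<le> norm A * norm B * K"
    using norm_matrix_mult_le by (intro exI[of _ 1]) auto
qed (auto simp: matrix_matrix_mult_def vec_eq_iff algebra_simps sum.distrib sum_distrib_left)

lemma bounded_linear_transpose: "bounded_linear (transpose :: real^'n^'m \<Rightarrow> real^'m^'n)"
proof (rule bounded_linear_intro[where K = 1])
  show "norm (transpose A) \<le> norm A * 1" for A :: "real^'n^'m" by (simp add: norm_transpose)
qed (auto simp: transpose_def vec_eq_iff)

lemmas matrix_mult_linear =
  bounded_bilinear.add_left[OF bounded_bilinear_matrix_mult]
  bounded_bilinear.add_right[OF bounded_bilinear_matrix_mult]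
  bounded_bilinear.diff_left[OF bounded_bilinear_matrix_mult]
  bounded_bilinear.diff_right[OF bounded_bilinear_matrix_mult]
  bounded_bilinear.scaleR_left[OF bounded_bilinear_matrix_mult]
  bounded_bilinear.scaleR_right[OF bounded_bilinear_matrix_mult]

lemma transpose_linear:
  fixes A B :: "real^'n^'m"
  shows "transpose (A + B) = transpose A + transpose B"
    and "transpose (A - B) = transpose A - transpose B"
    and "transpose (r *\<^sub>R A) = r *\<^sub>R transpose A"
  by (auto simp: transpose_def vec_eq_iff)

lemmas continuous_on_matrix_mult [continuous_intros] =
  bounded_bilinear.continuous_on[OF bounded_bilinear_matrix_mult]

lemmas continuous_on_transpose [continuous_intros] =
  bounded_linear.continuous_on[OF bounded_linear_transpose]

lemmas has_derivative_matrix_mult [derivative_intros] =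
  bounded_bilinear.FDERIV[OF bounded_bilinear_matrix_mult]

lemmas has_derivative_transpose [derivative_intros] =
  bounded_linear.has_derivative[OF bounded_linear_transpose]

section \<open>The defect of the Gram matrix as a measure of infeasibility\<close>

definition gram_defect :: "real^'p^'n \<Rightarrow> real^'p^'p" where
  "gram_defect X = transpose X ** X - mat 1"

text \<open>This substitution turns Gram matrices into polynomials in one symmetric matrix, so that
  identities can be checked as if it were a scalar.\<close>

lemma gram_eq: "transpose X ** X = mat 1 + gram_defect X"
  by (simp add: gram_defect_def)

lemma transpose_gram_defect [simp]: "transpose (gram_defect X) = gram_defect X"
  by (simp add: gram_defect_def transpose_linear matrix_transpose_mul)

lemma mem_\<Omega>_iff: "X \<in> \<Omega> r \<longleftrightarrow> norm (gram_defect X) \<le> r"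
  by (simp add: \<Omega>_def gram_defect_def)

lemma mem_stiefel_iff: "X \<in> stiefel \<longleftrightarrow> gram_defect X = 0"
  by (simp add: stiefel_def gram_defect_def)

lemma has_derivative_gram:
  fixes X :: "real^'p^'n"
  shows "((\<lambda>X. transpose X ** X) has_derivative (\<lambda>H. transpose X ** H + transpose H ** X)) (at X)"
  by (rule has_derivative_matrix_mult[OF has_derivative_transpose[OF has_derivative_ident] has_derivative_ident])

lemma continuous_on_gram_defect [continuous_intros]:
  "continuous_on S g \<Longrightarrow> continuous_on S (\<lambda>x. gram_defect (g x))"
  unfolding gram_defect_def by (intro continuous_intros)

text \<open>With the bound that follows, multiplication by \<open>X\<close> is nearly isometric when
  the defect is small.\<close>

lemma norm_matrix_mult_power2:
  "(norm (X ** M))\<^sup>2 = (norm M)\<^sup>2 + M \<bullet> (gram_defect X ** M)"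
  unfolding power2_norm_eq_inner
  by (simp add: inner_matrix_mult_left matrix_mul_assoc gram_eq matrix_mult_linear inner_add_right)

lemma inner_gram_defect_mult_le:
  "\<bar>M \<bullet> (gram_defect X ** M)\<bar> \<le> norm (gram_defect X) * (norm M)\<^sup>2"
proof -
  have "\<bar>M \<bullet> (gram_defect X ** M)\<bar> \<le> norm M * norm (gram_defect X ** M)" by (rule Cauchy_Schwarz_ineq2)
  also have "\<dots> \<le> norm M * (norm (gram_defect X) * norm M)"
    by (intro mult_left_mono norm_matrix_mult_le) auto
  finally show ?thesis by (simp add: power2_eq_square mult_ac)
qed

lemma compact_\<Omega>: "compact (\<Omega> r :: (real^'p^'n) set)"
proof -
  have "closed (\<Omega> r :: (real^'p^'n) set)"
    unfolding \<Omega>_def by (intro closed_Collect_le continuous_intros)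
  moreover have "bounded (\<Omega> r :: (real^'p^'n) set)"
  proof -
    let ?I = "mat 1 :: real^'p^'p"
    have "(norm X)\<^sup>2 \<le> norm ?I * (norm ?I + r)" if "X \<in> \<Omega> r" for X :: "real^'p^'n"
    proof -
      have "(norm X)\<^sup>2 = ?I \<bullet> (?I + gram_defect X)"
        using inner_matrix_mult_left[of X ?I X] by (simp add: power2_norm_eq_inner gram_eq)
      also have "\<dots> \<le> norm ?I * norm (?I + gram_defect X)" by (rule norm_cauchy_schwarz)
      also have "\<dots> \<le> norm ?I * (norm ?I + r)"
        using that norm_triangle_ineq[of ?I "gram_defect X"]
        by (intro mult_left_mono) (auto simp: mem_\<Omega>_iff)
      finally show ?thesis .
    qed
    then show ?thesis
      unfolding bounded_iff using real_le_rsqrt by blast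
  qed
  ultimately show ?thesis by (simp add: compact_eq_bounded_closed)
qed

text \<open>By duality from the bound on multiplication by \<open>X\<close>. The factor 2 is a crude
  replacement for the square root of 7/6.\<close>

lemma norm_transpose_mult_le:
  assumes "X \<in> \<Omega> (1/6)"
  shows "norm (transpose X ** U) \<le> 2 * norm U"
proof -
  let ?V = "transpose X ** U"
  have "(norm (X ** ?V))\<^sup>2 \<le> (2 * norm ?V)\<^sup>2"
  proof -
    have "norm (gram_defect X) * (norm ?V)\<^sup>2 \<le> 1/6 * (norm ?V)\<^sup>2"
      using assms by (intro mult_right_mono) (auto simp: mem_\<Omega>_iff)
    moreover have "(norm ?V)\<^sup>2 \<ge> 0" by simp
    ultimately show ?thesis
      using norm_matrix_mult_power2[of X ?V] inner_gram_defect_mult_le[of ?V X]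
      unfolding power_mult_distrib by (simp del: zero_le_power2)
  qed
  then have "norm (X ** ?V) \<le> 2 * norm ?V" by (rule power2_le_imp_le) simp
  then have "norm U * norm (X ** ?V) \<le> norm U * (2 * norm ?V)" by (intro mult_left_mono) auto
  moreover have "(norm ?V)\<^sup>2 = U \<bullet> (X ** ?V)"
    unfolding power2_norm_eq_inner using inner_matrix_mult_left[of "transpose X" U ?V] by simp
  moreover have "U \<bullet> (X ** ?V) \<le> norm U * norm (X ** ?V)" by (rule norm_cauchy_schwarz)
  ultimately have "norm ?V * norm ?V \<le> (2 * norm U) * norm ?V" by (simp add: power2_eq_square)
  then show ?thesis by (cases "norm ?V = 0") auto
qed

section \<open>The map \<open>\<A>\<close> and its derivative\<close>

text \<open>With \<open>c\<close> the defect, the factor \<open>1 - c / 2 + 3 c\<^sup>2 / 8\<close>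
  is the Taylor polynomial of \<open>(1 + c)\<close> to the power -1/2. Thus \<open>\<A>\<close>
  truncates the polar projection, which multiplies \<open>X\<close> by the inverse square root of
  its Gram matrix.\<close>

lemma \<A>_eq:
  "\<A> X = (1/8) *\<^sub>R (X ** (8 *\<^sub>R mat 1 - 4 *\<^sub>R gram_defect X + 3 *\<^sub>R (gram_defect X ** gram_defect X)))"
  unfolding \<A>_def gram_eq
  by (simp only: matrix_mult_linear matrix_mul_assoc matrix_mul_lid matrix_mul_rid)
     (simp add: vec_eq_iff algebra_simps)

lemma \<A>_stiefel: "X \<in> stiefel \<Longrightarrow> \<A> X = X"
  by (simp add: \<A>_eq mem_stiefel_iff matrix_mult_linear)

text \<open>The truncation is exact to second order, so the linear and quadratic terms in
  \<open>c\<close> cancel.\<close>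

lemma gram_defect_\<A>:
  fixes X :: "real^'p^'n"
  defines "c \<equiv> gram_defect X"
  shows "gram_defect (\<A> X) = (1/64) *\<^sub>R (40 *\<^sub>R (c ** c ** c) - 15 *\<^sub>R (c ** c ** c ** c)
           + 9 *\<^sub>R (c ** c ** c ** c ** c))"
proof -
  let ?B = "8 *\<^sub>R mat 1 - 4 *\<^sub>R c + 3 *\<^sub>R (c ** c)"
  have sym: "transpose c = c" by (simp add: c_def)
  have "transpose (\<A> X) ** \<A> X = (1/64) *\<^sub>R (?B ** (transpose X ** X) ** ?B)"
    by (simp add: \<A>_eq flip: c_def)
       (simp add: matrix_transpose_mul transpose_linear sym matrix_mult_linear(5,6) matrix_mul_assoc)
  also have "\<dots> = (1/64) *\<^sub>R (?B ** (mat 1 + c) ** ?B)" by (simp add: gram_eq c_def)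
  finally show ?thesis
    unfolding gram_defect_def[of "\<A> X"]
    by (simp only: matrix_mult_linear matrix_mul_assoc matrix_mul_lid matrix_mul_rid)
       (simp add: vec_eq_iff algebra_simps)
qed

text \<open>The moduli of the coefficients sum to 40 + 15 + 9 = 64, so bounding each power of
  \<open>c\<close> by \<open>\<kappa>\<close> suffices. This makes the bound on the field over
  \<open>\<Omega> (1/6)\<close> available at \<open>\<A> X\<close>.\<close>

lemma \<A>_mem_\<Omega>:
  assumes "X \<in> \<Omega> (1/6)"
  shows "\<A> X \<in> \<Omega> (1/6)"
proof -
  define c where "c = gram_defect X"
  define \<kappa> where "\<kappa> = norm c"
  have \<kappa>: "0 \<le> \<kappa>" "\<kappa> \<le> 1/6" using assms by (auto simp: \<kappa>_def c_def mem_\<Omega>_iff)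
  have step: "norm (M ** c) \<le> \<kappa>" if "norm M \<le> \<kappa>" for M
  proof -
    have "norm (M ** c) \<le> norm M * \<kappa>" unfolding \<kappa>_def by (rule norm_matrix_mult_le)
    also have "\<dots> \<le> \<kappa> * 1" using that \<kappa> by (intro mult_mono) auto
    finally show ?thesis by simp
  qed
  have 3: "norm (c ** c ** c) \<le> \<kappa>" and 4: "norm (c ** c ** c ** c) \<le> \<kappa>"
    and 5: "norm (c ** c ** c ** c ** c) \<le> \<kappa>"
    by (intro step; simp add: \<kappa>_def)+
  have "norm (gram_defect (\<A> X)) \<le> (1/64) * (40 * norm (c ** c ** c) + 15 * norm (c ** c ** c ** c)
      + 9 * norm (c ** c ** c ** c ** c))"
    unfolding gram_defect_\<A> c_def[symmetric] norm_scaleR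
    by (intro mult_mono norm_triangle_le norm_triangle_le_diff add_mono) auto
  then show ?thesis using 3 4 5 \<kappa> by (simp add: mem_\<Omega>_iff)
qed

definition d\<A> :: "real^'p^'n \<Rightarrow> real^'p^'n \<Rightarrow> real^'p^'n" where
  "d\<A> X H = (let P = transpose X ** X; Q = transpose X ** H + transpose H ** X in
     (1/8) *\<^sub>R (H ** (15 *\<^sub>R mat 1 - 10 *\<^sub>R P + 3 *\<^sub>R (P ** P))
       + X ** (3 *\<^sub>R (P ** Q + Q ** P) - 10 *\<^sub>R Q)))"

lemma has_derivative_\<A>: "(\<A> has_derivative d\<A> X) (at X)"
proof -
  have "((\<lambda>X. (1/8) *\<^sub>R (X ** (15 *\<^sub>R mat 1 - 10 *\<^sub>R (transpose X ** X)
           + 3 *\<^sub>R ((transpose X ** X) ** (transpose X ** X))))) has_derivative d\<A> X) (at X)"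
    unfolding d\<A>_def[abs_def] Let_def
    by (rule derivative_eq_intros has_derivative_gram refl)+
       (simp add: fun_eq_iff algebra_simps)
  then show ?thesis by (simp add: \<A>_def[abs_def])
qed

lemma \<J>\<^sub>\<A>_eq: "\<J>\<^sub>\<A> X = d\<A> X"
  unfolding \<J>\<^sub>\<A>_def by (rule frechet_derivative_at[OF has_derivative_\<A>, symmetric])

lemma continuous_d\<A>: "continuous_on UNIV (\<lambda>X. d\<A> X H)"
  unfolding d\<A>_def Let_def by (intro continuous_intros)

text \<open>\<open>\<A>\<close> is the gradient of a spectral function, so its derivative is a Hessian.\<close>

lemma d\<A>_symmetric: "d\<A> X H \<bullet> K = H \<bullet> d\<A> X K"
proof -
  define P where "P = transpose X ** X"
  define Q where "Q H = transpose X ** H + transpose H ** X" for H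
  define B where "B = 15 *\<^sub>R mat 1 - 10 *\<^sub>R P + 3 *\<^sub>R (P ** P)"
  define M where "M Z = 3 *\<^sub>R (P ** Z + Z ** P) - 10 *\<^sub>R Z" for Z
  have P: "transpose P = P" by (simp add: P_def matrix_transpose_mul)
  have B: "transpose B = B" by (simp add: B_def transpose_linear matrix_transpose_mul P)
  have Q: "transpose (Q H) = Q H" for H
    by (simp add: Q_def transpose_linear matrix_transpose_mul add.commute)
  have M_sym: "transpose (M (Q H)) = M (Q H)" for H
    by (simp add: M_def transpose_linear matrix_transpose_mul P Q add.commute)
  have M_adj: "M Z \<bullet> W = Z \<bullet> M W" for Z W
  proof -
    have "(P ** Z) \<bullet> W = Z \<bullet> (P ** W)" using inner_matrix_mult_left[of P Z W] P by simp
    moreover have "(Z ** P) \<bullet> W = Z \<bullet> (W ** P)" using inner_matrix_mult_right[of Z P W] P by simp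
    ultimately show ?thesis
      by (simp add: M_def inner_add_left inner_add_right inner_diff_left inner_diff_right)
  qed
  \<comment> \<open>A symmetric matrix pairs equally with \<open>transpose X ** K\<close> and with
    its transpose, hence with half of their sum \<open>Q K\<close>.\<close>
  have XM: "(X ** M (Q H)) \<bullet> K = (1/2) * (M (Q H) \<bullet> Q K)" for H K
  proof -
    have "M (Q H) \<bullet> (transpose K ** X) = M (Q H) \<bullet> (transpose X ** K)"
      using inner_transpose_transpose[of "M (Q H)" "transpose X ** K"]
      by (simp add: M_sym matrix_transpose_mul)
    then show ?thesis
      by (simp add: inner_matrix_mult_left Q_def inner_add_right)
  qed
  have d: "d\<A> X H = (1/8) *\<^sub>R (H ** B + X ** M (Q H))" for H
    by (simp add: d\<A>_def P_def Q_def B_def M_def Let_def)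
  have "(H ** B) \<bullet> K = H \<bullet> (K ** B)" using inner_matrix_mult_right[of H B K] B by simp
  moreover have "(X ** M (Q H)) \<bullet> K = H \<bullet> (X ** M (Q K))"
    using XM[of H K] XM[of K H] M_adj[of "Q H" "Q K"] by (simp add: inner_commute)
  ultimately show ?thesis by (simp add: d inner_add_left inner_add_right)
qed

text \<open>On a singular value \<open>s\<close>, \<open>\<A>\<close> acts as
  \<open>s (15 - 10 s\<^sup>2 + 3 s\<^sup>4) / 8\<close>, whose derivative is
  \<open>(15/8) (1 - s\<^sup>2)\<^sup>2\<close>. The direction \<open>X ** c\<close> only changes
  singular values, so it is multiplied by 15/8 times the square of \<open>c\<close>.\<close>

lemma d\<A>_normal:
  fixes X :: "real^'p^'n"
  defines "c \<equiv> gram_defect X"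
  shows "d\<A> X (X ** c) = (15/8) *\<^sub>R (X ** c ** (c ** c))"
proof -
  have sym: "transpose c = c" by (simp add: c_def)
  have P: "transpose X ** X = mat 1 + c" by (simp add: c_def gram_eq)
  have Q: "transpose X ** (X ** c) + transpose (X ** c) ** X = 2 *\<^sub>R c + 2 *\<^sub>R (c ** c)"
  proof -
    have "transpose X ** (X ** c) = c + c ** c"
      by (simp add: matrix_mul_assoc P matrix_mult_linear)
    moreover have "transpose (X ** c) ** X = c + c ** c"
      by (simp add: matrix_transpose_mul sym P matrix_mult_linear flip: matrix_mul_assoc)
    ultimately show ?thesis by (simp add: scaleR_2)
  qed
  show ?thesis
    unfolding d\<A>_def Let_def Q P
    by (simp only: matrix_mult_linear matrix_mul_assoc matrix_mul_lid matrix_mul_rid)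
       (simp add: vec_eq_iff algebra_simps)
qed

section \<open>The penalty gradient, feasibility of stationary points and invariance\<close>

lemma has_derivative_quartic_penalty:
  "((\<lambda>X. \<beta> / 4 * (norm (transpose X ** X - mat 1))\<^sup>2) has_derivative
     (\<lambda>H. (\<beta> *\<^sub>R (X ** gram_defect X)) \<bullet> H)) (at X)"
proof -
  have eq: "(transpose H ** X) \<bullet> gram_defect X = (X ** gram_defect X) \<bullet> H"
    "gram_defect X \<bullet> (transpose H ** X) = (X ** gram_defect X) \<bullet> H"
    "(transpose X ** H) \<bullet> gram_defect X = (X ** gram_defect X) \<bullet> H"
    "gram_defect X \<bullet> (transpose X ** H) = (X ** gram_defect X) \<bullet> H" for H
  proof -
    have 1: "gram_defect X \<bullet> (transpose X ** H) = (X ** gram_defect X) \<bullet> H"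
      by (simp add: inner_matrix_mult_left)
    have 2: "gram_defect X \<bullet> (transpose H ** X) = (X ** gram_defect X) \<bullet> H"
      using inner_transpose_transpose[of "gram_defect X" "transpose X ** H"] 1
      by (simp add: matrix_transpose_mul)
    show "(transpose H ** X) \<bullet> gram_defect X = (X ** gram_defect X) \<bullet> H"
      "gram_defect X \<bullet> (transpose H ** X) = (X ** gram_defect X) \<bullet> H"
      "(transpose X ** H) \<bullet> gram_defect X = (X ** gram_defect X) \<bullet> H"
      "gram_defect X \<bullet> (transpose X ** H) = (X ** gram_defect X) \<bullet> H"
      using 1 2 by (auto simp: inner_commute)
  qed
  show ?thesis
    unfolding power2_norm_eq_inner
    by (rule derivative_eq_intros has_derivative_gram refl)+
       (simp add: fun_eq_iff inner_add_left inner_add_right eq flip: gram_defect_def)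
qed

text \<open>Pairing the equation with \<open>X ** c\<close> and using symmetry leaves the penalty
  term, quadratic in \<open>\<nu>\<close>, against \<open>\<nu>\<close> times a multiple of
  \<open>\<kappa>\<^sup>2\<close>. Since \<open>\<nu>\<close> is comparable to
  \<open>\<kappa>\<close>, smallness of \<open>\<kappa>\<close> forces it to vanish.\<close>

lemma stationary_imp_stiefel:
  fixes X V :: "real^'p^'n"
  assumes X: "X \<in> \<Omega> (1/6)" and V: "16 * norm V \<le> \<beta>" and \<beta>: "\<beta> > 0"
    and eq: "d\<A> X V + \<beta> *\<^sub>R (X ** gram_defect X) = 0"
  shows "X \<in> stiefel"
proof -
  define c where "c = gram_defect X"
  define \<kappa> where "\<kappa> = norm c"
  define \<nu> where "\<nu> = norm (X ** c)"
  have \<kappa>: "0 \<le> \<kappa>" "\<kappa> \<le> 1/6" using X by (auto simp: \<kappa>_def c_def mem_\<Omega>_iff)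
  have "(X ** c) \<bullet> d\<A> X V + \<beta> * \<nu>\<^sup>2 = (X ** c) \<bullet> (d\<A> X V + \<beta> *\<^sub>R (X ** c))"
    by (simp add: inner_add_right \<nu>_def power2_norm_eq_inner)
  also have "\<dots> = 0" using eq by (simp add: c_def)
  finally have "\<beta> * \<nu>\<^sup>2 = - ((X ** c) \<bullet> d\<A> X V)" by simp
  also have "(X ** c) \<bullet> d\<A> X V = (15/8) * ((X ** c ** (c ** c)) \<bullet> V)"
    by (simp add: d\<A>_symmetric[symmetric] c_def d\<A>_normal)
  also have "- \<dots> \<le> (15/8) * (\<nu> * \<kappa>\<^sup>2 * (\<beta> / 16))"
  proof -
    have "\<bar>(X ** c ** (c ** c)) \<bullet> V\<bar> \<le> norm (X ** c ** (c ** c)) * norm V" by (rule Cauchy_Schwarz_ineq2)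
    also have "\<dots> \<le> (\<nu> * norm (c ** c)) * (\<beta> / 16)"
      unfolding \<nu>_def using V by (intro mult_mono norm_matrix_mult_le) auto
    also have "\<dots> \<le> (\<nu> * \<kappa>\<^sup>2) * (\<beta> / 16)"
      unfolding \<kappa>_def power2_eq_square using \<beta>
      by (intro mult_right_mono mult_left_mono norm_matrix_mult_le) (auto simp: \<nu>_def)
    finally show ?thesis by linarith
  qed
  finally have "\<beta> * (\<nu> * \<nu>) \<le> \<beta> * (\<nu> * (15/128 * \<kappa>\<^sup>2))" by (simp add: power2_eq_square mult_ac)
  then have "\<nu> * \<nu> \<le> \<nu> * (15/128 * \<kappa>\<^sup>2)" using \<beta> by simp
  then have "\<nu> \<le> 15/128 * \<kappa>\<^sup>2"
    by (cases "\<nu> = 0") (auto simp: \<nu>_def)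
  then have "\<nu>\<^sup>2 \<le> (15/128 * \<kappa>\<^sup>2)\<^sup>2" by (intro power_mono) (auto simp: \<nu>_def)
  \<comment> \<open>Near isometry of \<open>X\<close> loses at most the fraction
    \<open>\<kappa> \<le> 1/6\<close>.\<close>
  moreover have "\<nu>\<^sup>2 \<ge> 5/6 * \<kappa>\<^sup>2"
  proof -
    have "\<nu>\<^sup>2 \<ge> \<kappa>\<^sup>2 - \<kappa> * \<kappa>\<^sup>2"
      using norm_matrix_mult_power2[of X c] inner_gram_defect_mult_le[of c X]
      by (simp add: \<nu>_def \<kappa>_def c_def)
    moreover have "\<kappa> * \<kappa>\<^sup>2 \<le> 1/6 * \<kappa>\<^sup>2" using \<kappa> by (intro mult_right_mono) auto
    ultimately show ?thesis by linarith
  qed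
  moreover have "(15/128 * \<kappa>\<^sup>2)\<^sup>2 \<le> 1/6 * \<kappa>\<^sup>2"
  proof -
    have "(15/128 * \<kappa>\<^sup>2)\<^sup>2 = (225/16384 * \<kappa>\<^sup>2) * \<kappa>\<^sup>2" by (simp add: power2_eq_square)
    also have "\<dots> \<le> 1/6 * \<kappa>\<^sup>2"
    proof (rule mult_right_mono)
      have "\<kappa>\<^sup>2 \<le> (1/6)\<^sup>2" using \<kappa> by (intro power_mono)
      then show "225/16384 * \<kappa>\<^sup>2 \<le> 1/6" by (simp add: power2_eq_square)
    qed simp
    finally show ?thesis .
  qed
  ultimately have "\<kappa>\<^sup>2 \<le> 0" by linarith
  then show ?thesis by (simp add: \<kappa>_def c_def mem_stiefel_iff)
qed

text \<open>The penalty step alone multiplies \<open>X\<close> by \<open>N = 1 - a c\<close>, which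
  contracts the defect by \<open>1 - 2 * a\<close> to first order; the step size bound makes this
  factor nonnegative. The bound on \<open>D\<close> makes the perturbation \<open>U\<close> small
  relative to the resulting gain.\<close>

lemma gradient_step_mem_\<Omega>:
  fixes X D :: "real^'p^'n"
  assumes X: "X \<in> \<Omega> (1/6)" and D: "60 * norm D \<le> \<beta>" and \<beta>: "\<beta> > 0"
    and \<eta>: "0 < \<eta>" "\<eta> \<le> 1 / (2 * \<beta>)"
  shows "X - \<eta> *\<^sub>R (D + \<beta> *\<^sub>R (X ** (transpose X ** X - mat 1))) \<in> \<Omega> (1/6)"
proof -
  define c where "c = gram_defect X"
  define \<kappa> where "\<kappa> = norm c"
  define a where "a = \<eta> * \<beta>"
  define U where "U = \<eta> *\<^sub>R D"
  define N where "N = mat 1 - a *\<^sub>R c"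
  let ?X' = "X - \<eta> *\<^sub>R (D + \<beta> *\<^sub>R (X ** (transpose X ** X - mat 1)))"
  let ?W = "N ** (transpose X ** U)"
  have \<kappa>: "0 \<le> \<kappa>" "\<kappa> \<le> 1/6" using X by (auto simp: \<kappa>_def c_def mem_\<Omega>_iff)
  have a: "0 < a" "a \<le> 1/2" using \<eta> \<beta> by (auto simp: a_def field_simps)
  have U: "norm U \<le> a / 60"
    using mult_left_mono[OF D, of \<eta>] \<eta> by (simp add: U_def a_def)
  have sym: "transpose c = c" by (simp add: c_def)
  have N_sym: "transpose N = N" by (simp add: N_def transpose_linear sym)
  have X': "?X' = X ** N - U"
    by (simp add: N_def U_def a_def c_def gram_defect_def matrix_mult_linear algebra_simps)
  have "transpose (X ** N - U) ** (X ** N - U) =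
      N ** (transpose X ** X) ** N - ?W - transpose ?W + transpose U ** U"
    by (simp add: matrix_mult_linear transpose_linear matrix_transpose_mul N_sym matrix_mul_assoc)
  then have "gram_defect ?X' = (N ** (mat 1 + c) ** N - mat 1) - ?W - transpose ?W + transpose U ** U"
    unfolding X' gram_defect_def[of "X ** N - U"] by (simp add: gram_eq c_def)
  also have "N ** (mat 1 + c) ** N - mat 1 =
      (1 - 2 * a) *\<^sub>R c - (2 * a - a\<^sup>2) *\<^sub>R (c ** c) + a\<^sup>2 *\<^sub>R (c ** c ** c)"
    unfolding N_def
    by (simp only: matrix_mult_linear matrix_mul_assoc matrix_mul_lid matrix_mul_rid)
       (simp add: vec_eq_iff algebra_simps power2_eq_square)
  finally have "norm (gram_defect ?X') \<le>
      (1 - 2 * a) * norm c + (2 * a - a\<^sup>2) * norm (c ** c) + a\<^sup>2 * norm (c ** c ** c)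
      + norm ?W + norm (transpose ?W) + norm (transpose U ** U)"
  proof -
    assume e: "gram_defect ?X' = (1 - 2 * a) *\<^sub>R c - (2 * a - a\<^sup>2) *\<^sub>R (c ** c) + a\<^sup>2 *\<^sub>R (c ** c ** c)
       - ?W - transpose ?W + transpose U ** U"
    have "2 * a - a\<^sup>2 \<ge> 0" using a mult_mono[of a 1 a 1] by (simp add: power2_eq_square)
    then show ?thesis
      unfolding e using a
      by (intro norm_triangle_le norm_triangle_le_diff add_mono) auto
  qed
  moreover have "(1 - 2 * a) * norm c \<le> (1 - 2 * a) * (1/6)"
    using a \<kappa> by (intro mult_left_mono) (auto simp: \<kappa>_def)
  moreover have cc: "norm (c ** c) \<le> 1/36"
  proof -
    have "norm (c ** c) \<le> \<kappa> * \<kappa>" unfolding \<kappa>_def by (rule norm_matrix_mult_le)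
    also have "\<dots> \<le> 1/6 * (1/6)" using \<kappa> by (intro mult_mono) auto
    finally show ?thesis by simp
  qed
  moreover have "norm (c ** c ** c) \<le> 1/36"
  proof -
    have "norm (c ** c ** c) \<le> norm (c ** c) * \<kappa>" unfolding \<kappa>_def by (rule norm_matrix_mult_le)
    also have "\<dots> \<le> 1/36 * 1" using \<kappa> cc by (intro mult_mono) auto
    finally show ?thesis by simp
  qed
  moreover have "norm ?W \<le> 13/3 * norm U / 2"
  proof -
    let ?V = "transpose X ** U"
    have V: "norm ?V \<le> 2 * norm U" by (rule norm_transpose_mult_le[OF X])
    have "?W = ?V - a *\<^sub>R (c ** ?V)" by (simp add: N_def matrix_mult_linear)
    also have "norm \<dots> \<le> norm ?V + a * norm (c ** ?V)"
      using norm_triangle_ineq4[of ?V "a *\<^sub>R (c ** ?V)"] a by simp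
    also have "a * norm (c ** ?V) \<le> 1/2 * (1/6 * norm ?V)"
    proof (rule mult_mono)
      have "norm (c ** ?V) \<le> \<kappa> * norm ?V" unfolding \<kappa>_def by (rule norm_matrix_mult_le)
      also have "\<dots> \<le> 1/6 * norm ?V" using \<kappa> by (intro mult_right_mono) auto
      finally show "norm (c ** ?V) \<le> 1/6 * norm ?V" .
    qed (use a in auto)
    finally show ?thesis using V by linarith
  qed
  moreover have "norm (transpose ?W) = norm ?W" by (rule norm_transpose)
  moreover have "norm (transpose U ** U) \<le> norm U"
  proof -
    have "norm (transpose U ** U) \<le> norm U * norm U"
      using norm_matrix_mult_le[of "transpose U" U] by (simp add: norm_transpose)
    also have "\<dots> \<le> norm U * 1" using U a by (intro mult_left_mono) auto
    finally show ?thesis by simp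
  qed
  moreover have "(2 * a - a\<^sup>2) * norm (c ** c) + a\<^sup>2 * norm (c ** c ** c) \<le> 2 * a * (1/36)"
  proof -
    have "2 * a - a\<^sup>2 \<ge> 0" using a mult_mono[of a 1 a 1] by (simp add: power2_eq_square)
    then have "(2 * a - a\<^sup>2) * norm (c ** c) \<le> (2 * a - a\<^sup>2) * (1/36)"
      using cc by (intro mult_left_mono)
    moreover have "a\<^sup>2 * norm (c ** c ** c) \<le> a\<^sup>2 * (1/36)"
      using \<open>norm (c ** c ** c) \<le> 1/36\<close> by (intro mult_left_mono) auto
    ultimately show ?thesis by (simp add: algebra_simps)
  qed
  \<comment> \<open>The \<open>c\<close> terms total at most \<open>1/6 - 5 a / 18\<close>, and the
    \<open>U\<close> terms at most \<open>(16/3) * norm U \<le> 4 a / 45\<close>.\<close>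
  ultimately have "norm (gram_defect ?X') \<le> 1/6" using U a by (simp add: algebra_simps)
  then show ?thesis by (simp add: mem_\<Omega>_iff)
qed

section \<open>Convergence of the iteration\<close>

lemma locally_lipschitz_imp_continuous_on:
  assumes "locally_lipschitz f"
  shows "continuous_on S f"
proof (rule continuous_at_imp_continuous_on, intro ballI)
  fix x
  obtain u L where u: "u > 0" "L-lipschitz_on (cball x u) f"
    using assms unfolding locally_lipschitz_def by blast
  have "x \<in> interior (cball x u)" using u(1) centre_in_ball[of x u] ball_subset_cball[of x u]
    by (meson interiorI open_ball)
  then show "isCont f x"
    by (rule continuous_on_interior[OF lipschitz_on_continuous_on[OF u(2)]])
qed

text \<open>Absorbing the tail of the convergent noise series into the iterates removes the noise.\<close>

theorem theorem4p12:
  fixes f :: "real^'p^'n \<Rightarrow> real"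
    and D\<^sub>f :: "real^'p^'n \<Rightarrow> (real^'p^'n) set"
    and X D G E :: "nat \<Rightarrow> real^'p^'n"
    and \<eta> :: "nat \<Rightarrow> real"
    and \<beta> Mtilde Mhat :: real
  assumes lip: "locally_lipschitz f"
    and A1: "path_differentiable f"
    and A2: "interior {f X |X. X \<in> stiefel \<and> 0 \<in> projected_subdiff f X} = {}"
    and cons: "conservative_field D\<^sub>f"
    and pot: "admits_potential D\<^sub>f f"
    and beta_pos: "\<beta> > 0"
    and init: "X 0 \<in> \<Omega> (1/6)"
    and iter: "\<And>k. X (Suc k) =
                 X k - \<eta> k *\<^sub>R (D k + \<beta> *\<^sub>R (X k ** (transpose (X k) ** X k - mat 1)))"
    and C1_split: "\<And>k. D k = G k + E k"
    and C1_noise: "convergent (\<lambda>N. \<Sum>k\<le>N. \<eta> k *\<^sub>R E k)"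
    and C1_avg: "\<And>r Xt. strict_mono (r :: nat \<Rightarrow> nat) \<Longrightarrow> (\<lambda>j. X (r j)) \<longlonglongrightarrow> Xt \<Longrightarrow>
                   (\<lambda>N. infdist ((1 / real N) *\<^sub>R (\<Sum>j<N. G (r j))) (\<J>\<^sub>\<A> Xt ` D\<^sub>f (\<A> Xt))) \<longlonglongrightarrow> 0"
    and C2_D: "\<And>k. norm (D k) \<le> Mtilde"
    and C2_Df: "\<And>Y V. Y \<in> \<Omega> (1/6) \<Longrightarrow> V \<in> D\<^sub>f Y \<Longrightarrow> norm V \<le> Mhat"
    and C2_beta: "\<beta> \<ge> Max {16 * M\<^sub>1 f, 60 * Mtilde, 16 * Mhat}"
    and C3_pos: "\<And>k. \<eta> k > 0"
    and C3_sum: "filterlim (\<lambda>N. \<Sum>k\<le>N. \<eta> k) at_top sequentially"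
    and C3_sq: "summable (\<lambda>k. (\<eta> k)\<^sup>2)"
    and C3_bound: "\<And>k. \<eta> k \<le> 1 / (2 * \<beta>)"
    and C4: "interior {f X |X. X \<in> stiefel \<and> 0 \<in> \<J>\<^sub>\<A> X ` D\<^sub>f X} = {}"
  shows "convergent (\<lambda>k. penalty f \<beta> (X k)) \<and>
         (\<forall>Xs. (\<exists>r :: nat \<Rightarrow> nat. strict_mono r \<and> (\<lambda>j. X (r j)) \<longlonglongrightarrow> Xs) \<longrightarrow>
            Xs \<in> {X \<in> stiefel. 0 \<in> \<J>\<^sub>\<A> X ` D\<^sub>f X})"
proof -
  define b where "b X = \<beta> *\<^sub>R (X ** gram_defect X)" for X :: "real^'p^'n"
  define S where "S X = d\<A> X ` D\<^sub>f (\<A> X)" for X :: "real^'p^'n"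
  have beta: "60 * Mtilde \<le> \<beta>" "16 * Mhat \<le> \<beta>" using C2_beta by simp_all
  have X_in: "X k \<in> \<Omega> (1/6)" for k
  proof (induction k)
    case (Suc k)
    have "60 * norm (D k) \<le> \<beta>" using C2_D[of k] beta(1) by linarith
    then show ?case
      unfolding iter by (intro gradient_step_mem_\<Omega> Suc beta_pos C3_pos C3_bound)
  qed (rule init)
  obtain L where L: "(\<lambda>N. \<Sum>k\<le>N. \<eta> k *\<^sub>R E k) \<longlonglongrightarrow> L"
    using C1_noise by (auto simp: convergent_def)
  \<comment> \<open>Summing strictly below \<open>n\<close> makes the increment from
    \<open>Z k\<close> to \<open>Z (Suc k)\<close> the noise of step \<open>k\<close>, cancelling it
    in the recursion for \<open>Y\<close>.\<close>
  define Z where "Z n = (\<Sum>k<n. \<eta> k *\<^sub>R E k)" for n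
  have "(\<lambda>n. Z (Suc n)) \<longlonglongrightarrow> L" using L by (simp add: Z_def lessThan_Suc_atMost)
  then have Z: "Z \<longlonglongrightarrow> L" by (simp add: filterlim_sequentially_Suc)
  define Y where "Y n = X n + (Z n - L)" for n
  interpret averaged_recursion X Y G b S \<eta> "\<Omega> (1/6)"
  proof
    have "(\<lambda>k. sqrt ((\<eta> k)\<^sup>2)) \<longlonglongrightarrow> sqrt 0"
      by (intro tendsto_real_sqrt summable_LIMSEQ_zero C3_sq)
    then show "\<eta> \<longlonglongrightarrow> 0" using C3_pos by (simp add: less_imp_le)
    have "filterlim (\<lambda>n. \<Sum>k<Suc n. \<eta> k) at_top sequentially"
      using C3_sum by (simp add: lessThan_Suc_atMost)
    then show "filterlim (\<lambda>n. \<Sum>k<n. \<eta> k) at_top sequentially"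
      by (simp only: filterlim_sequentially_Suc[where f = "\<lambda>n. \<Sum>k<n. \<eta> k"])
    show "continuous_on UNIV b" unfolding b_def by (intro continuous_intros)
    show "compact (S x)" for x
      unfolding S_def
    proof (rule compact_continuous_image)
      show "continuous_on (D\<^sub>f (\<A> x)) (d\<A> x)"
        by (intro linear_continuous_on has_derivative_bounded_linear[OF has_derivative_\<A>])
      show "compact (D\<^sub>f (\<A> x))" using cons by (simp add: conservative_field_def)
    qed
    show "S x \<noteq> {}" for x using cons by (simp add: S_def conservative_field_def)
    show "(\<lambda>N. infdist ((1 / real N) *\<^sub>R (\<Sum>j<N. G (r j))) (S x)) \<longlonglongrightarrow> 0"
      if "strict_mono r" "(\<lambda>j. X (r j)) \<longlonglongrightarrow> x" for r :: "nat \<Rightarrow> nat" and x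
      using C1_avg[OF that] by (simp add: S_def \<J>\<^sub>\<A>_eq)
    show "(\<lambda>k. Y k - X k) \<longlonglongrightarrow> 0" unfolding Y_def using LIM_zero[OF Z] by simp
    show "Y (Suc k) = Y k - \<eta> k *\<^sub>R (G k + b (X k))" for k
      by (simp add: Y_def Z_def iter C1_split b_def gram_defect_def algebra_simps)
  qed (use X_in C3_pos compact_\<Omega> in auto)
  \<comment> \<open>On the Stiefel manifold \<open>\<A>\<close> is the identity and the penalty
    vanishes, so critical values of \<open>penalty f \<beta>\<close> in
    \<open>\<Omega> (1/6)\<close> are among the values of \<open>f\<close> in
    \<open>C4\<close>.\<close>
  have stationary: "x \<in> stiefel \<and> 0 \<in> \<J>\<^sub>\<A> x ` D\<^sub>f x \<and> penalty f \<beta> x = f x"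
    if x: "x \<in> \<Omega> (1/6)" and bx: "- b x \<in> S x" for x
  proof -
    obtain V where V: "V \<in> D\<^sub>f (\<A> x)" "- b x = d\<A> x V" using bx unfolding S_def by blast
    have "norm V \<le> Mhat" by (rule C2_Df[OF \<A>_mem_\<Omega>[OF x] V(1)])
    then have "16 * norm V \<le> \<beta>" using beta(2) by linarith
    moreover have "d\<A> x V + \<beta> *\<^sub>R (x ** gram_defect x) = 0"
      unfolding V(2)[symmetric] b_def by simp
    ultimately have "x \<in> stiefel" by (rule stationary_imp_stiefel[OF x _ beta_pos])
    moreover from this have "b x = 0" by (simp add: b_def mem_stiefel_iff matrix_mult_linear)
    ultimately show ?thesis
      using V by (auto simp: \<A>_stiefel \<J>\<^sub>\<A>_eq penalty_def mem_stiefel_iff gram_defect_def image_iff)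
  qed
  define q where "q X = \<beta> / 4 * (norm (transpose X ** X - mat 1))\<^sup>2" for X :: "real^'p^'n"
  have q: "(q has_derivative (\<lambda>v. b x \<bullet> v)) (at x)" for x
    unfolding q_def b_def by (rule has_derivative_quartic_penalty)
  have A_lip: "\<exists>L. L-lipschitz_on B \<A>" if "bounded B" for B :: "(real^'p^'n) set"
    using has_derivative_lipschitz_on_bounded[OF has_derivative_\<A> continuous_d\<A> that] .
  have q_lip: "\<exists>L. L-lipschitz_on B q" if "bounded B" for B
    by (rule has_derivative_lipschitz_on_bounded[OF q _ that]) (intro continuous_intros b_cont)
  have pen: "penalty f \<beta> x = f (\<A> x) + q x" for x by (simp add: penalty_def q_def)
  have cont: "continuous_on UNIV (penalty f \<beta>)"
  proof -
    have "continuous_on UNIV \<A>"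
      by (intro has_derivative_continuous_on[where f' = d\<A>] has_derivative_\<A>)
    moreover have "continuous_on UNIV q"
      by (intro has_derivative_continuous_on[where f' = "\<lambda>x v. b x \<bullet> v"] q)
    ultimately show ?thesis
      unfolding pen[abs_def]
      by (intro continuous_on_add continuous_on_compose2[OF locally_lipschitz_imp_continuous_on[OF lip]]) auto
  qed
  have descent: "penalty f \<beta> (\<gamma> T) \<le> penalty f \<beta> (\<gamma> 0) - (norm (\<gamma> T - \<gamma> 0))\<^sup>2 / T"
    if "T > 0" "L-lipschitz_on {0..T} \<gamma>"
      "\<And>t v. 0 < t \<Longrightarrow> t < T \<Longrightarrow> (\<gamma> has_vector_derivative v) (at t) \<Longrightarrow> - v - b (\<gamma> t) \<in> S (\<gamma> t)"
    for \<gamma> T L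
    unfolding pen
    by (rule lyapunov_descent[OF A1 cons pot has_derivative_\<A> A_lip d\<A>_symmetric q q_lip that(1,2)
          that(3)[unfolded S_def]])
  have sard: "interior (penalty f \<beta> ` {x \<in> \<Omega> (1/6). - b x \<in> S x}) = {}"
  proof -
    have "penalty f \<beta> ` {x \<in> \<Omega> (1/6). - b x \<in> S x} \<subseteq> {f X |X. X \<in> stiefel \<and> 0 \<in> \<J>\<^sub>\<A> X ` D\<^sub>f X}"
      using stationary by blast
    then show ?thesis using interior_mono C4 by blast
  qed
  have "Xs \<in> {X \<in> stiefel. 0 \<in> \<J>\<^sub>\<A> X ` D\<^sub>f X}"
    if r: "strict_mono r" "(\<lambda>j. X (r j)) \<longlonglongrightarrow> Xs" for r :: "nat \<Rightarrow> nat" and Xs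
  proof -
    have "- b Xs \<in> S Xs" by (rule lyapunov_convergence(2)[OF cont descent sard r])
    moreover have "Xs \<in> \<Omega> (1/6)"
      using closed_sequentially[OF compact_imp_closed[OF compact_\<Omega>], of "\<lambda>j. X (r j)"] X_in r(2) by blast
    ultimately show ?thesis using stationary by blast
  qed
  moreover have "convergent (\<lambda>k. penalty f \<beta> (X k))"
    by (rule lyapunov_convergence(1)[OF cont descent sard])
  ultimately show ?thesis by blast
qed

end
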